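(* Consider the two following pairs of vector fields (Kumpera-Ruiz normal forms) on $\mathbb{R}^9$, for $c_9=0$ and $c_9=1$: $$\kappa_1^9=\frac{\partial}{\partial x_9},$$ $$\kappa_2^9(c_9)=(x_9+c_9)\frac{\partial}{\partial x_8}+(x_8+1)\frac{\partial}{\partial x_7}+x_7\frac{\partial}{\partial x_6}+\frac{\partial}{\partial x_5}+x_6\Big(x_5\frac{\partial}{\partial x_4}+x_4\frac{\partial}{\partial x_3}+x_3\frac{\partial}{\partial x_2}+\frac{\partial}{\partial x_1}\Big).$$ The two distributions spanned by these pairs are not locally equivalent at zero, although both of them have the same singularity type $a_0a_0a_1a_2a_0a_0$ at zero.
   Context: Two distributions $\mathcal{D}$, $\tilde{\mathcal{D}}$ on $\mathbb{R}^n$ are locally equivalent at zero if there is a smooth diffeomorphism $\varphi$ between two neighborhoods of zero with $\varphi(0)=0$ and $\varphi_*\mathcal{D}=\tilde{\mathcal{D}}$. The derived flag of a distribution is $\mathcal{D}^{(0)}=\mathcal{D}$, $\mathcal{D}^{(i+1)}=\mathcal{D}^{(i)}+[\mathcal{D}^{(i)},\mathcal{D}^{(i)}]$. A Goursat structure on a manifold $M$ of dimension $n\geq 3$ is a smooth rank two distribution with $\dim\mathcal{D}^{(i)}(p)=i+2$ for $0\le i\le n-2$ and every $p$; the distributions in the claim are Goursat structures. Singularity type of a Goursat structure. For $0\le i\le n-4$, $\mathcal{C}_i\subset\mathcal{D}^{(i)}$ is the unique involutive subdistribution of constant corank one in $\mathcal{D}^{(i)}$ with $[\mathcal{C}_i,\mathcal{D}^{(i+1)}]\subset\mathcal{D}^{(i+1)}$.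 For $0\le i\le n-5$, $S_0^{(i)}=\{q:\mathcal{D}^{(i)}(q)=\mathcal{C}_{i+1}(q)\}$; $S_0^{(i)}=\emptyset$ for $i\ge n-4$. For $1\le j\le i$, $S_j^{(i)}=\{q\in S_{j-1}^{(i)}:\mathcal{D}^{(i-j)}(q)\cap T_qS_{j-1}^{(i)}\neq\mathcal{C}_{i-j}(q)\}$; $S_j^{(i)}=\emptyset$ for $j\ge i+1$. These sets are empty or smooth submanifolds. The singularity type at $p$ is the word $\delta_{\mathcal{D}}(p)=w_{n-4}\cdots w_0$ with $w_i=a_{j+1}$ if there is a (necessarily unique) $j\ge0$ with $p\in S_j^{(i+j)}$, and $w_i=a_0$ otherwise. *)

theory Defs
  imports "HOL-Analysis.Analysis"
begin

section \<open>Smooth maps on open sets\<close>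

primrec Ck_on :: "nat \<Rightarrow> 'a::euclidean_space set \<Rightarrow> ('a \<Rightarrow> 'b::real_normed_vector) \<Rightarrow> bool" where
  "Ck_on 0 U f \<longleftrightarrow> continuous_on U f"
| "Ck_on (Suc k) U f \<longleftrightarrow>
     (\<forall>x\<in>U. f differentiable (at x)) \<and> (\<forall>v. Ck_on k U (\<lambda>x. frechet_derivative f (at x) v))"

definition smooth_on :: "'a::euclidean_space set \<Rightarrow> ('a \<Rightarrow> 'b::real_normed_vector) \<Rightarrow> bool" where
  "smooth_on U f \<longleftrightarrow> open U \<and> (\<forall>k. Ck_on k U f)"

definition diffeomorphism ::
    "'a::euclidean_space set \<Rightarrow> 'b::euclidean_space set \<Rightarrow> ('a \<Rightarrow> 'b) \<Rightarrow> ('b \<Rightarrow> 'a) \<Rightarrow> bool" where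
  "diffeomorphism U V f g \<longleftrightarrow> homeomorphism U V f g \<and> smooth_on U f \<and> smooth_on V g"

text \<open>The tangent space at \<open>q\<close> of a subset \<open>S\<close> of the ambient space: velocities at \<open>q\<close> of smooth
  curves lying in \<open>S\<close>. It is the usual tangent space whenever \<open>S\<close> is a smooth submanifold; it is
  only used for such \<open>S\<close>.\<close>

definition tangent_space :: "'a::euclidean_space set \<Rightarrow> 'a \<Rightarrow> 'a set" where
  "tangent_space S q = {v. \<exists>(c :: real \<Rightarrow> 'a) e. e > 0 \<and> smooth_on {-e<..<e} c \<and>
     c ` {-e<..<e} \<subseteq> S \<and> c 0 = q \<and> (c has_vector_derivative v) (at 0)}"


section \<open>Vector fields and distributions\<close>

text \<open>A distribution assigns a linear subspace to each point. Vector fields and distributions live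
  on a Euclidean space, whose tangent spaces are identified with the space itself.\<close>

type_synonym 'a distribution = "'a \<Rightarrow> 'a set"

definition lie_bracket ::
    "('a::euclidean_space \<Rightarrow> 'a) \<Rightarrow> ('a \<Rightarrow> 'a) \<Rightarrow> 'a \<Rightarrow> 'a" where
  "lie_bracket X Y p =
     frechet_derivative Y (at p) (X p) - frechet_derivative X (at p) (Y p)"

definition smooth_distribution :: "nat \<Rightarrow> 'a::euclidean_space distribution \<Rightarrow> bool" where
  "smooth_distribution k D \<longleftrightarrow>
     (\<forall>p. \<exists>U X. open U \<and> p \<in> U \<and> (\<forall>i<k. smooth_on U (X i)) \<and>
       (\<forall>q\<in>U. D q = span ((\<lambda>i. X i q) ` {..<k}) \<and> dim (D q) = k))"

definition local_section :: "'a::euclidean_space distribution \<Rightarrow> 'a set \<Rightarrow> ('a \<Rightarrow> 'a) \<Rightarrow> bool" where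
  "local_section D U X \<longleftrightarrow> smooth_on U X \<and> (\<forall>q\<in>U. X q \<in> D q)"

definition bracket_subset ::
    "'a::euclidean_space distribution \<Rightarrow> 'a distribution \<Rightarrow> 'a distribution \<Rightarrow> bool" where
  "bracket_subset C D E \<longleftrightarrow>
     (\<forall>U X Y. local_section C U X \<and> local_section D U Y \<longrightarrow> (\<forall>p\<in>U. lie_bracket X Y p \<in> E p))"

definition involutive :: "'a::euclidean_space distribution \<Rightarrow> bool" where
  "involutive C \<longleftrightarrow> bracket_subset C C C"

definition derived :: "'a::euclidean_space distribution \<Rightarrow> 'a distribution" where
  "derived D p = span (D p \<union>
     {lie_bracket X Y p | X Y. \<exists>U. p \<in> U \<and> local_section D U X \<and> local_section D U Y})"

primrec derived_flag :: "'a::euclidean_space distribution \<Rightarrow> nat \<Rightarrow> 'a distribution" where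
  "derived_flag D 0 = D"
| "derived_flag D (Suc i) = derived (derived_flag D i)"

text \<open>The condition on derivatives below says \<open>f\<^sub>* D = E\<close>.\<close>

definition locally_equivalent_at_zero ::
    "'a::euclidean_space distribution \<Rightarrow> 'a distribution \<Rightarrow> bool" where
  "locally_equivalent_at_zero D E \<longleftrightarrow>
     (\<exists>U V f g. 0 \<in> U \<and> 0 \<in> V \<and> diffeomorphism U V f g \<and> f 0 = 0 \<and>
       (\<forall>x\<in>U. frechet_derivative f (at x) ` D x = E (f x)))"

definition goursat :: "'a::euclidean_space distribution \<Rightarrow> bool" where
  "goursat D \<longleftrightarrow> 3 \<le> DIM('a) \<and> smooth_distribution 2 D \<and>
     (\<forall>i \<le> DIM('a) - 2. \<forall>p. dim (derived_flag D i p) = i + 2)"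


section \<open>The singularity type of a Goursat structure\<close>

text \<open>For a Goursat structure, \<open>D\<^sup>(\<^sup>i\<^sup>)\<close> has rank \<open>i + 2\<close>, so corank one means rank \<open>i + 1\<close>.\<close>

definition is_canonical_subdistribution ::
    "'a::euclidean_space distribution \<Rightarrow> nat \<Rightarrow> 'a distribution \<Rightarrow> bool" where
  "is_canonical_subdistribution D i C \<longleftrightarrow>
     smooth_distribution (i + 1) C \<and> (\<forall>p. C p \<subseteq> derived_flag D i p) \<and> involutive C \<and>
     bracket_subset C (derived_flag D (i + 1)) (derived_flag D (i + 1))"

text \<open>Meaningful for \<open>i \<le> n - 4\<close>, where \<open>n\<close> is the dimension.\<close>

definition canonical_subdistribution ::
    "'a::euclidean_space distribution \<Rightarrow> nat \<Rightarrow> 'a distribution" where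
  "canonical_subdistribution D i = (THE C. is_canonical_subdistribution D i C)"

text \<open>\<open>singular_locus D i j\<close> is \<open>S\<^sub>j\<^sup>(\<^sup>i\<^sup>)\<close>.\<close>

primrec singular_locus :: "'a::euclidean_space distribution \<Rightarrow> nat \<Rightarrow> nat \<Rightarrow> 'a set" where
  "singular_locus D i 0 =
     (if i + 5 \<le> DIM('a) then {q. derived_flag D i q = canonical_subdistribution D (i + 1) q}
      else {})"
| "singular_locus D i (Suc j) =
     (if Suc j \<le> i
      then {q \<in> singular_locus D i j.
              derived_flag D (i - Suc j) q \<inter> tangent_space (singular_locus D i j) q
                \<noteq> canonical_subdistribution D (i - Suc j) q}
      else {})"

text \<open>The letter \<open>\<aa> k\<close> stands for \<open>a\<^sub>k\<close>.\<close>

datatype letter = \<aa> nat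

definition singularity_letter :: "'a::euclidean_space distribution \<Rightarrow> 'a \<Rightarrow> nat \<Rightarrow> letter" where
  "singularity_letter D p i =
     (if \<exists>j. p \<in> singular_locus D (i + j) j
      then \<aa> ((THE j. p \<in> singular_locus D (i + j) j) + 1)
      else \<aa> 0)"

text \<open>The word is written with decreasing indices, from \<open>n - 4\<close> down to \<open>0\<close>.\<close>

definition singularity_type :: "'a::euclidean_space distribution \<Rightarrow> 'a \<Rightarrow> letter list" where
  "singularity_type D p = map (singularity_letter D p) (rev [0..<DIM('a) - 3])"


section \<open>The two Kumpera-Ruiz normal forms\<close>

text \<open>The nine indices of \<open>real^9\<close> are \<open>1, \<dots>, 9\<close>, the index \<open>9\<close> being equal to \<open>0\<close> in the
  type \<open>9\<close>. The vector \<open>axis i 1\<close> is the coordinate field \<open>\<partial>/\<partial>x\<^sub>i\<close>.\<close>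

definition kappa1 :: "real^9 \<Rightarrow> real^9" where
  "kappa1 x = axis 9 1"

definition kappa2 :: "real \<Rightarrow> real^9 \<Rightarrow> real^9" where
  "kappa2 c x =
     (x$9 + c) *\<^sub>R axis 8 1 + (x$8 + 1) *\<^sub>R axis 7 1 + x$7 *\<^sub>R axis 6 1 + axis 5 1
     + x$6 *\<^sub>R (x$5 *\<^sub>R axis 4 1 + x$4 *\<^sub>R axis 3 1 + x$3 *\<^sub>R axis 2 1 + axis 1 1)"

definition kumpera_ruiz :: "real \<Rightarrow> (real^9) distribution" where
  "kumpera_ruiz c p = span {kappa1 p, kappa2 c p}"

end

theory Submission
  imports Defs
begin

text \<open>Both distributions are cut out by Pfaffian forms. For \<open>0 \<le> j \<le> 6\<close> put
  \<open>\<theta>\<^sub>j = dx\<^sub>a - (x\<^sub>b + k) dx\<^sub>d\<close>, where \<open>(a, b, d)\<close> runs through \<open>(8,9,5), (7,8,5), (6,7,5), (1,6,5),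
  (4,5,1), (3,4,1), (2,3,1)\<close> and \<open>k\<close> is \<open>c\<close> for \<open>j = 0\<close>, one for \<open>j = 1\<close> and zero otherwise. The
  differential \<open>d\<theta>\<^sub>j\<close> is \<open>dx\<^sub>d \<and> dx\<^sub>b\<close>, and it vanishes on the kernel of the preceding form,
  whereas \<open>d\<theta>\<^sub>i\<close> does not vanish on the common kernel of \<open>\<theta>\<^sub>i, \<dots>, \<theta>\<^sub>6\<close>. Hence taking brackets drops
  one form at a time, and \<open>D\<^sup>(\<^sup>i\<^sup>)\<close> is the common kernel of \<open>\<theta>\<^sub>i, \<dots>, \<theta>\<^sub>6\<close>
  (\<open>derived_flag_kumpera_ruiz\<close>). So the ranks are those of a Goursat structure, and the canonical
  subdistribution of index \<open>i\<close> consists of the vectors whose first \<open>8 - i\<close> coordinates vanish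
  (\<open>canonical_kumpera_ruiz\<close>). The only nonempty first singular locus is \<open>x\<^sub>6 = 0\<close>, for \<open>i = 3\<close>; it is
  followed by \<open>x\<^sub>6 = x\<^sub>7 = 0\<close>, and the next locus misses zero. This is the singularity type, whatever
  the constant \<open>c\<close> is, because \<open>c\<close> enters \<open>\<theta>\<^sub>0\<close> alone.

  For the inequivalence, let \<open>f\<close> map the distribution with constant \<open>0\<close> to that with constant \<open>c'\<close>
  and fix zero. It respects the derived flags (\<open>maps_flag\<close>) and the canonical subdistributions
  (\<open>maps_characteristic\<close>), so \<open>f\<^sub>1\<close> depends on \<open>x\<^sub>1, x\<^sub>2, x\<^sub>3\<close>, \<open>f\<^sub>4\<close> on \<open>x\<^sub>1, \<dots>, x\<^sub>4\<close> and \<open>f\<^sub>5\<close> on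
  \<open>x\<^sub>1, \<dots>, x\<^sub>5\<close>. Let \<open>W = x\<^sub>5 \<partial>\<^sub>4 + x\<^sub>4 \<partial>\<^sub>3 + x\<^sub>3 \<partial>\<^sub>2 + \<partial>\<^sub>1\<close>. Then \<open>f\<^sub>5\<close> is \<open>W f\<^sub>4\<close> divided by \<open>W f\<^sub>1\<close>, and
  therefore affine in \<open>x\<^sub>5\<close> (\<open>component_5_affine\<close>): the third derivative \<open>x\<^sub>5\<close> of a function changes
  affinely under prolonged contact transformations. On the other hand, along an integral curve
  parametrised by \<open>x\<^sub>5 = t\<close> the successive derivatives of \<open>x\<^sub>1\<close> are \<open>x\<^sub>6, x\<^sub>7, x\<^sub>8 + 1, x\<^sub>9 + c\<close>, so
  curves through zero have \<open>x\<^sub>1 = t\<^sup>3 / 6 + c t\<^sup>4 / 24 + \<dots>\<close>. A change of parameter without quadratic term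
  together with a linear change of \<open>x\<^sub>1\<close> to this order cannot create the quartic term out of \<open>c = 0\<close>
  (\<open>normal_form_constant_zero\<close>).\<close>

section \<open>Calculus of smooth maps\<close>

lemma Ck_on_cong:
  assumes "open U" "\<And>x. x \<in> U \<Longrightarrow> f x = g x" "Ck_on k U f"
  shows "Ck_on k U g"
  using assms(2,3)
proof (induction k arbitrary: f g)
  case 0
  then show ?case by (auto cong: continuous_on_cong)
next
  case (Suc k)
  have d: "(g has_derivative frechet_derivative f (at x)) (at x)" if "x \<in> U" for x
  proof (rule has_derivative_transform_within_open[OF _ assms(1) that])
    show "(f has_derivative frechet_derivative f (at x)) (at x)"
      using Suc.prems(2) that by (simp add: frechet_derivative_works[symmetric])
  qed (rule Suc.prems(1))
  then have "frechet_derivative g (at x) = frechet_derivative f (at x)" if "x \<in> U" for x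
    using that by (metis frechet_derivative_at)
  then have eq: "frechet_derivative f (at x) v = frechet_derivative g (at x) v" if "x \<in> U" for x v
    using that by metis
  have "Ck_on k U (\<lambda>x. frechet_derivative g (at x) v)" for v
    by (rule Suc.IH[OF eq]) (use Suc.prems(2) in simp_all)
  then show ?case using d by (auto intro: differentiableI)
qed

lemma Ck_on_Suc_imp: "Ck_on (Suc k) U f \<Longrightarrow> Ck_on k U f"
proof (induction k arbitrary: f)
  case 0
  then show ?case
    by (auto intro: continuous_at_imp_continuous_on differentiable_imp_continuous_within)
next
  case (Suc k)
  then show ?case unfolding Ck_on.simps(2)[of "Suc k"] Ck_on.simps(2)[of k] by blast
qed

lemma frechet_derivative_plus_at:
  assumes "f differentiable (at x)" "g differentiable (at x)"
  shows "frechet_derivative (\<lambda>x. f x + g x) (at x) v =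
    frechet_derivative f (at x) v + frechet_derivative g (at x) v"
  using frechet_derivative_at[OF has_derivative_add[OF assms(1)[unfolded frechet_derivative_works] assms(2)[unfolded frechet_derivative_works]], symmetric]
  by simp

lemma Ck_on_add:
  assumes "open U" "Ck_on k U f" "Ck_on k U g"
  shows "Ck_on k U (\<lambda>x. f x + g x)"
  using assms(2,3)
proof (induction k arbitrary: f g)
  case (Suc k)
  have "Ck_on k U (\<lambda>x. frechet_derivative (\<lambda>x. f x + g x) (at x) v)" for v
    by (rule Ck_on_cong[OF assms(1) _ Suc.IH[of "\<lambda>x. frechet_derivative f (at x) v" "\<lambda>x. frechet_derivative g (at x) v"]])
      (use Suc.prems in \<open>auto simp: frechet_derivative_plus_at\<close>)
  then show ?case using Suc.prems by auto
qed (auto intro: continuous_intros)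

text \<open>Covers products, scalar multiples and inner products at once.\<close>

lemma Ck_on_bilinear:
  assumes "bounded_bilinear B" "open U" "Ck_on k U f" "Ck_on k U g"
  shows "Ck_on k U (\<lambda>x. B (f x) (g x))"
  using assms(3,4)
proof (induction k arbitrary: f g)
  case 0
  then show ?case using bounded_bilinear.continuous_on[OF assms(1)] by auto
next
  case (Suc k)
  have d: "((\<lambda>x. B (f x) (g x)) has_derivative
      (\<lambda>v. B (f x) (frechet_derivative g (at x) v) + B (frechet_derivative f (at x) v) (g x))) (at x)"
    if "x \<in> U" for x
    using Suc.prems that
    by (intro bounded_bilinear.FDERIV[OF assms(1)]) (auto simp: frechet_derivative_works[symmetric])
  have fd: "frechet_derivative (\<lambda>x. B (f x) (g x)) (at x) v =
      B (f x) (frechet_derivative g (at x) v) + B (frechet_derivative f (at x) v) (g x)"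
    if "x \<in> U" for x v
    using frechet_derivative_at[OF d[OF that]] by metis
  have low: "Ck_on k U f" "Ck_on k U g" "Ck_on k U (\<lambda>x. frechet_derivative f (at x) v)"
    "Ck_on k U (\<lambda>x. frechet_derivative g (at x) v)" for v
    using Suc.prems by (simp_all add: Ck_on_Suc_imp del: Ck_on.simps(2)) simp_all
  have "Ck_on k U (\<lambda>x. frechet_derivative (\<lambda>x. B (f x) (g x)) (at x) v)" for v
    by (rule Ck_on_cong[OF assms(2) fd[symmetric] Ck_on_add[OF assms(2) Suc.IH Suc.IH]])
      (simp_all add: low)
  then show ?case using d by (auto intro: differentiableI)
qed

lemma Ck_on_const: "Ck_on k U (\<lambda>x. c)"
  by (induction k arbitrary: c) auto

lemma Ck_on_bounded_linear:
  assumes "bounded_linear T"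
  shows "Ck_on k U T"
proof (cases k)
  case 0
  then show ?thesis using assms by (simp add: linear_continuous_on)
next
  case (Suc l)
  have "frechet_derivative T (at x) = T" for x
    using bounded_linear_imp_has_derivative[OF assms] by (metis frechet_derivative_at)
  then show ?thesis
    using Suc bounded_linear_imp_differentiable[OF assms] by (simp add: Ck_on_const)
qed

lemma smooth_on_open: "smooth_on U f \<Longrightarrow> open U"
  by (simp add: smooth_on_def)

lemma smooth_on_cong:
  "(\<And>x. x \<in> U \<Longrightarrow> f x = g x) \<Longrightarrow> smooth_on U f \<Longrightarrow> smooth_on U g"
  unfolding smooth_on_def using Ck_on_cong by blast

lemma smooth_on_const: "open U \<Longrightarrow> smooth_on U (\<lambda>x. c)"
  by (simp add: smooth_on_def Ck_on_const)

lemma smooth_on_linear: "open U \<Longrightarrow> bounded_linear T \<Longrightarrow> smooth_on U T"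
  by (simp add: smooth_on_def Ck_on_bounded_linear)

lemma smooth_on_id: "open U \<Longrightarrow> smooth_on U (\<lambda>x. x)"
  by (rule smooth_on_linear) (auto simp: bounded_linear_ident)

lemma smooth_on_add: "smooth_on U f \<Longrightarrow> smooth_on U g \<Longrightarrow> smooth_on U (\<lambda>x. f x + g x)"
  by (simp add: smooth_on_def Ck_on_add)

lemma smooth_on_bilinear:
  "bounded_bilinear B \<Longrightarrow> smooth_on U f \<Longrightarrow> smooth_on U g \<Longrightarrow> smooth_on U (\<lambda>x. B (f x) (g x))"
  by (simp add: smooth_on_def Ck_on_bilinear)

lemmas smooth_on_scaleR = smooth_on_bilinear[OF bounded_bilinear_scaleR]
lemmas smooth_on_mult = smooth_on_bilinear[OF bounded_bilinear_mult]
lemmas smooth_on_inner = smooth_on_bilinear[OF bounded_bilinear_inner]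

lemma smooth_on_sum:
  assumes "open U" "\<And>i. i \<in> I \<Longrightarrow> smooth_on U (f i)"
  shows "smooth_on U (\<lambda>x. \<Sum>i\<in>I. f i x)"
  using assms(2) by (induction I rule: infinite_finite_induct)
    (auto intro: smooth_on_add smooth_on_const assms(1))

lemma smooth_on_differentiable: "smooth_on U f \<Longrightarrow> x \<in> U \<Longrightarrow> f differentiable (at x)"
  unfolding smooth_on_def by (metis Ck_on.simps(2))

lemma smooth_on_has_derivative:
  "smooth_on U f \<Longrightarrow> x \<in> U \<Longrightarrow> (f has_derivative frechet_derivative f (at x)) (at x)"
  using smooth_on_differentiable frechet_derivative_works by blast

lemma smooth_on_frechet_derivative:
  "smooth_on U f \<Longrightarrow> smooth_on U (\<lambda>x. frechet_derivative f (at x) v)"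
  unfolding smooth_on_def by (metis Ck_on.simps(2))

lemma smooth_on_continuous_on: "smooth_on U f \<Longrightarrow> continuous_on U f"
  unfolding smooth_on_def by (metis Ck_on.simps(1))

lemma smooth_on_vec_nth:
  fixes f :: "'a::euclidean_space \<Rightarrow> real^'n"
  assumes "smooth_on U f"
  shows "smooth_on U (\<lambda>x. f x $ m)"
  using smooth_on_inner[OF assms smooth_on_const[of U "axis m 1"]] assms
  by (simp add: inner_axis smooth_on_open)

section \<open>Symmetry of second derivatives\<close>

lemma mvt_along:
  fixes h :: "'a::euclidean_space \<Rightarrow> real"
  assumes "s > 0" "\<And>t. 0 \<le> t \<Longrightarrow> t \<le> s \<Longrightarrow> h differentiable (at (q + t *\<^sub>R u))"
  obtains t where "0 < t" "t < s" "h (q + s *\<^sub>R u) - h q = s * frechet_derivative h (at (q + t *\<^sub>R u)) u"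
proof -
  let ?D = "\<lambda>t. frechet_derivative h (at (q + t *\<^sub>R u))"
  have d: "((\<lambda>t. h (q + t *\<^sub>R u)) has_derivative (\<lambda>r. ?D t (r *\<^sub>R u))) (at t)" if "0 \<le> t" "t \<le> s" for t
  proof -
    have "((\<lambda>t. q + t *\<^sub>R u) has_derivative (\<lambda>r. r *\<^sub>R u)) (at t)"
      by (auto intro!: derivative_eq_intros)
    from has_derivative_compose[OF this, of h "?D t"] assms(2)[OF that]
    show ?thesis by (simp add: frechet_derivative_works)
  qed
  obtain t where t: "t \<in> {0<..<s}" "h (q + s *\<^sub>R u) - h (q + 0 *\<^sub>R u) = ?D t ((s - 0) *\<^sub>R u)"
    using mvt_simple[OF assms(1), of "\<lambda>t. h (q + t *\<^sub>R u)" "\<lambda>t r. ?D t (r *\<^sub>R u)"]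
      has_derivative_at_withinI[OF d] by (metis atLeastAtMost_iff)
  have "linear (?D t)"
    using assms(2)[of t] t by (auto intro!: linear_frechet_derivative)
  then have "?D t (s *\<^sub>R u) = s * ?D t u" by (simp add: linear_cmul)
  with t that show ?thesis by auto
qed

text \<open>The mixed second difference of \<open>h\<close> over the parallelogram spanned by \<open>s u\<close> and \<open>s v\<close> is symmetric
  in \<open>u\<close> and \<open>v\<close>. Applying the mean value theorem first to the difference in direction \<open>v\<close> and then to
  the derivative along \<open>u\<close> writes it as a mixed second derivative, taken in one fixed order, at some
  nearby point.\<close>

lemma second_difference:
  fixes h :: "'a::euclidean_space \<Rightarrow> real"
  assumes sm: "smooth_on U h" and sub: "ball p e \<subseteq> U"
    and s: "s > 0" "s * (norm u + norm v) < e"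
  obtains q where "dist p q \<le> s * (norm u + norm v)"
    "h (p + s *\<^sub>R u + s *\<^sub>R v) - h (p + s *\<^sub>R u) - h (p + s *\<^sub>R v) + h p
      = s * s * frechet_derivative (\<lambda>x. frechet_derivative h (at x) u) (at q) v"
proof -
  let ?hu = "\<lambda>x. frechet_derivative h (at x) u"
  have near: "norm (a *\<^sub>R u + b *\<^sub>R v) \<le> s * (norm u + norm v)"
    if "0 \<le> a" "a \<le> s" "0 \<le> b" "b \<le> s" for a b
  proof -
    have "norm (a *\<^sub>R u + b *\<^sub>R v) \<le> a * norm u + b * norm v"
      using norm_triangle_ineq[of "a *\<^sub>R u" "b *\<^sub>R v"] that by simp
    also have "\<dots> \<le> s * (norm u + norm v)"
      using that by (auto simp: distrib_left intro!: add_mono mult_right_mono)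
    finally show ?thesis .
  qed
  have dnear: "dist p (p + (a *\<^sub>R u + b *\<^sub>R v)) \<le> s * (norm u + norm v)"
    if "0 \<le> a" "a \<le> s" "0 \<le> b" "b \<le> s" for a b
  proof -
    have "dist p (p + w) = norm w" for w by (simp add: dist_norm)
    then show ?thesis using near[OF that] by simp
  qed
  have inU: "p + (a *\<^sub>R u + b *\<^sub>R v) \<in> U"
    if "0 \<le> a" "a \<le> s" "0 \<le> b" "b \<le> s" for a b
    using dnear[OF that] s sub by (auto simp: subset_iff)
  let ?g = "\<lambda>x. h (x + s *\<^sub>R v) - h x"
  have dg: "(?g has_derivative (\<lambda>w. frechet_derivative h (at (x + s *\<^sub>R v)) w - frechet_derivative h (at x) w)) (at x)"
    if "x \<in> U" "x + s *\<^sub>R v \<in> U" for x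
  proof -
    have "((\<lambda>x. x + s *\<^sub>R v) has_derivative (\<lambda>w. w)) (at x)"
      by (auto intro!: derivative_eq_intros)
    from has_derivative_compose[OF this smooth_on_has_derivative[OF sm that(2)]]
    show ?thesis
      using smooth_on_has_derivative[OF sm that(1)] by (rule has_derivative_diff)
  qed
  have dgt: "?g differentiable at (p + t *\<^sub>R u)" if "0 \<le> t" "t \<le> s" for t
    using dg[of "p + t *\<^sub>R u"] inU[of t 0] inU[of t s] that s
    by (auto simp: differentiable_def algebra_simps)
  obtain t where t: "0 < t" "t < s" "?g (p + s *\<^sub>R u) - ?g p = s * frechet_derivative ?g (at (p + t *\<^sub>R u)) u"
    by (rule mvt_along[where h = ?g, OF s(1) dgt])
  have "p + t *\<^sub>R u \<in> U" "p + t *\<^sub>R u + s *\<^sub>R v \<in> U"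
    using inU[of t 0] inU[of t s] t(1,2) s by (simp_all add: add.assoc)
  from frechet_derivative_at[OF dg[OF this], symmetric]
  have "frechet_derivative ?g (at (p + t *\<^sub>R u)) u = ?hu (p + t *\<^sub>R u + s *\<^sub>R v) - ?hu (p + t *\<^sub>R u)"
    by simp
  moreover have dhu: "?hu differentiable at (p + t *\<^sub>R u + r *\<^sub>R v)" if "0 \<le> r" "r \<le> s" for r
    using smooth_on_differentiable[OF smooth_on_frechet_derivative[OF sm]] inU[of t r] t that
    by (simp add: add.assoc)
  moreover obtain r where r: "0 < r" "r < s" "?hu (p + t *\<^sub>R u + s *\<^sub>R v) - ?hu (p + t *\<^sub>R u)
      = s * frechet_derivative ?hu (at (p + t *\<^sub>R u + r *\<^sub>R v)) v"
    by (rule mvt_along[where h = ?hu, OF s(1) dhu])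
  ultimately have "?g (p + s *\<^sub>R u) - ?g p
      = s * s * frechet_derivative ?hu (at (p + (t *\<^sub>R u + r *\<^sub>R v))) v"
    using t(3) r(3) by (simp add: add.assoc)
  then show ?thesis
    using dnear[of t r] t(1,2) r(1,2) by (intro that[of "p + (t *\<^sub>R u + r *\<^sub>R v)"]) simp_all
qed

text \<open>The mixed derivatives in the two orders take the same value at two points arbitrarily close to
  \<open>p\<close>, since both are the same second difference divided by \<open>s\<^sup>2\<close>; continuity brings both points to \<open>p\<close>.\<close>

lemma second_derivative_symmetric:
  fixes h :: "'a::euclidean_space \<Rightarrow> real"
  assumes sm: "smooth_on U h" and p: "p \<in> U"
  shows "frechet_derivative (\<lambda>x. frechet_derivative h (at x) u) (at p) v
       = frechet_derivative (\<lambda>x. frechet_derivative h (at x) v) (at p) u"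
proof (rule ccontr)
  let ?D = "\<lambda>u v q. frechet_derivative (\<lambda>x. frechet_derivative h (at x) u) (at q) v"
  assume "?D u v p \<noteq> ?D v u p"
  then have pos: "dist (?D u v p) (?D v u p) / 2 > 0" (is "?r > 0") by simp
  have "\<exists>d>0. \<forall>q. dist p q < d \<longrightarrow> dist (?D u v p) (?D u v q) < ?r" for u v
  proof -
    have "continuous_on U (?D u v)"
      by (intro smooth_on_continuous_on smooth_on_frechet_derivative sm)
    then have "isCont (?D u v) p"
      using sm p by (simp add: continuous_on_eq_continuous_at smooth_on_open)
    then show ?thesis
      using pos unfolding continuous_at_eps_delta by (metis dist_commute)
  qed
  then obtain d where d: "\<And>u v. d u v > 0" "\<And>u v q. dist p q < d u v \<Longrightarrow> dist (?D u v p) (?D u v q) < ?r"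
    by metis
  obtain e0 where e0: "e0 > 0" "ball p e0 \<subseteq> U"
    using sm p by (meson open_contains_ball smooth_on_open)
  \<comment> \<open>a radius that serves the continuity of both mixed derivatives\<close>
  define e where "e = min e0 (min (d u v) (d v u))"
  have e: "e > 0" "ball p e \<subseteq> U" "e \<le> d u v" "e \<le> d v u"
    using e0 d unfolding e_def by (auto simp: subset_iff)
  define s where "s = e / 2 / (norm u + norm v + 1)"
  have nn: "0 < norm u + norm v + 1" by (simp add: add_nonneg_pos)
  have s: "s > 0" using e nn by (simp add: s_def)
  have "s * (norm u + norm v) \<le> s * (norm u + norm v + 1)" using s by simp
  also have "\<dots> = e / 2"
    by (rule nonzero_eq_divide_eq[THEN iffD1, OF _ s_def]) (use nn in simp)
  finally have se: "s * (norm u + norm v) < e" using e by linarith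
  from second_difference[OF sm e(2) s se] obtain q where
    q: "dist p q \<le> s * (norm u + norm v)"
      "h (p + s *\<^sub>R u + s *\<^sub>R v) - h (p + s *\<^sub>R u) - h (p + s *\<^sub>R v) + h p = s * s * ?D u v q" .
  have se': "s * (norm v + norm u) < e" using se by (simp add: add.commute)
  from second_difference[OF sm e(2) s se'] obtain q' where
    q': "dist p q' \<le> s * (norm v + norm u)"
      "h (p + s *\<^sub>R v + s *\<^sub>R u) - h (p + s *\<^sub>R v) - h (p + s *\<^sub>R u) + h p = s * s * ?D v u q'" .
  have "s * s * ?D u v q = s * s * ?D v u q'"
    using q(2) q'(2) by (simp add: algebra_simps)
  then have "?D u v q = ?D v u q'" using s by simp
  moreover have "dist (?D u v p) (?D u v q) < ?r" using d(2)[of q u v] q(1) se e by linarith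
  moreover have "dist (?D v u p) (?D v u q') < ?r" using d(2)[of q' v u] q'(1) se' e by linarith
  ultimately show False
    using dist_triangle2[of "?D u v p" "?D v u p" "?D u v q"] by (simp add: field_simps)
qed

section \<open>Lie derivatives and brackets\<close>

definition lie_derivative ::
    "('a::euclidean_space \<Rightarrow> 'a) \<Rightarrow> ('a \<Rightarrow> 'b::real_normed_vector) \<Rightarrow> 'a \<Rightarrow> 'b" where
  "lie_derivative X h x = frechet_derivative h (at x) (X x)"

text \<open>Expanding the field in the basis reduces statements about Lie derivatives to derivatives in
  constant directions, the only ones that smoothness speaks of.\<close>

lemma lie_derivative_basis:
  assumes "h differentiable (at x)"
  shows "lie_derivative X h x = (\<Sum>b\<in>Basis. (X x \<bullet> b) *\<^sub>R frechet_derivative h (at x) b)"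
proof -
  have "lie_derivative X h x = frechet_derivative h (at x) (\<Sum>b\<in>Basis. (X x \<bullet> b) *\<^sub>R b)"
    by (simp only: lie_derivative_def euclidean_representation)
  then show ?thesis
    using linear_frechet_derivative[OF assms] by (simp add: linear_sum linear_cmul)
qed

lemma smooth_on_lie_derivative:
  assumes "smooth_on U X" "smooth_on U h"
  shows "smooth_on U (lie_derivative X h)"
  by (rule smooth_on_cong[OF lie_derivative_basis[symmetric]])
    (use assms in \<open>auto intro!: smooth_on_sum smooth_on_scaleR smooth_on_inner smooth_on_const
      smooth_on_frechet_derivative smooth_on_differentiable simp: smooth_on_open\<close>)

lemma lie_derivative_cong:
  assumes "open U" "p \<in> U" "\<And>x. x \<in> U \<Longrightarrow> f x = g x" "f differentiable (at p)"
  shows "lie_derivative X g p = lie_derivative X f p"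
proof -
  have "(g has_derivative frechet_derivative f (at p)) (at p)"
    by (rule has_derivative_transform_within_open[OF assms(4)[unfolded frechet_derivative_works] assms(1-3)])
  from frechet_derivative_at[OF this, symmetric] show ?thesis by (simp add: lie_derivative_def)
qed

lemma lie_derivative_add:
  assumes "f differentiable (at p)" "g differentiable (at p)"
  shows "lie_derivative X (\<lambda>x. f x + g x) p = lie_derivative X f p + lie_derivative X g p"
  using assms by (simp add: lie_derivative_def frechet_derivative_plus_at)

lemma lie_derivative_mult:
  fixes f g :: "'a::euclidean_space \<Rightarrow> real"
  assumes "f differentiable (at p)" "g differentiable (at p)"
  shows "lie_derivative X (\<lambda>x. f x * g x) p = lie_derivative X f p * g p + f p * lie_derivative X g p"
proof -
  have "((\<lambda>x. f x * g x) has_derivative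
      (\<lambda>v. f p * frechet_derivative g (at p) v + frechet_derivative f (at p) v * g p)) (at p)"
    by (rule has_derivative_mult[OF assms[unfolded frechet_derivative_works]])
  from frechet_derivative_at[OF this, symmetric] show ?thesis
    by (simp add: lie_derivative_def)
qed

lemma lie_derivative_const [simp]: "lie_derivative X (\<lambda>x. c) p = 0"
  by (simp add: lie_derivative_def)

lemma lie_derivative_bounded_linear:
  assumes "bounded_linear T" "f differentiable (at p)"
  shows "lie_derivative X (\<lambda>x. T (f x)) p = T (lie_derivative X f p)"
proof -
  have "((\<lambda>x. T (f x)) has_derivative (\<lambda>v. T (frechet_derivative f (at p) v))) (at p)"
    by (rule bounded_linear.has_derivative[OF assms(1) assms(2)[unfolded frechet_derivative_works]])
  from frechet_derivative_at[OF this, symmetric] show ?thesis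
    by (simp add: lie_derivative_def)
qed

lemma lie_derivative_id: "lie_derivative X (\<lambda>x. x) p = X p"
  by (simp add: lie_derivative_def frechet_derivative_at[OF has_derivative_ident, symmetric])

lemma lie_bracket_eq: "lie_bracket X Y p = lie_derivative X Y p - lie_derivative Y X p"
  by (simp add: lie_bracket_def lie_derivative_def)

text \<open>The bracket acts on functions as the commutator. In coordinates the second derivatives of \<open>h\<close>
  contribute the same double sum to both iterated derivatives, by symmetry, and cancel.\<close>

lemma lie_derivative_lie_bracket:
  fixes h :: "'a::euclidean_space \<Rightarrow> real"
  assumes X: "smooth_on U X" and Y: "smooth_on U Y" and h: "smooth_on U h" and p: "p \<in> U"
  shows "lie_derivative (lie_bracket X Y) h p =
    lie_derivative X (lie_derivative Y h) p - lie_derivative Y (lie_derivative X h) p"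
proof -
  have dX: "X differentiable at p" and dY: "Y differentiable at p" and dh: "h differentiable at p"
    using assms by (auto intro: smooth_on_differentiable)
  let ?h = "\<lambda>v x. frechet_derivative h (at x) v"
  have sh: "smooth_on U (?h v)" for v by (rule smooth_on_frechet_derivative[OF h])
  have sum: "lie_derivative X (lie_derivative Y h) p = ?h (lie_derivative X Y p) p +
      (\<Sum>b\<in>Basis. \<Sum>c\<in>Basis. (Y p \<bullet> b) * (X p \<bullet> c) * frechet_derivative (?h b) (at p) c)"
    if X: "smooth_on U X" and Y: "smooth_on U Y" for X Y
  proof -
    have dX: "X differentiable at p" and dY: "Y differentiable at p"
      using X Y p by (auto intro: smooth_on_differentiable)
    have inner: "lie_derivative X (\<lambda>x. Y x \<bullet> b) p = lie_derivative X Y p \<bullet> b" for b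
      using lie_derivative_bounded_linear[OF bounded_linear_inner_left dY] .
    have dYb: "(\<lambda>x. Y x \<bullet> b) differentiable at p" for b
      using dY by (intro differentiable_inner) auto
    have dhb: "?h b differentiable at p" for b
      using sh p by (rule smooth_on_differentiable)
    have "lie_derivative X (lie_derivative Y h) p =
        lie_derivative X (\<lambda>x. \<Sum>b\<in>Basis. (Y x \<bullet> b) * ?h b x) p"
      using p h by (intro lie_derivative_cong[of U])
        (auto simp: lie_derivative_basis smooth_on_open smooth_on_differentiable[OF h]
          intro!: differentiable_sum differentiable_mult dYb dhb)
    also have "\<dots> = (\<Sum>b\<in>Basis. lie_derivative X (\<lambda>x. (Y x \<bullet> b) * ?h b x) p)"
    proof -
      have "((\<lambda>x. \<Sum>b\<in>Basis. (Y x \<bullet> b) * ?h b x) has_derivative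
          (\<lambda>v. \<Sum>b\<in>Basis. frechet_derivative (\<lambda>x. (Y x \<bullet> b) * ?h b x) (at p) v)) (at p)"
        by (intro has_derivative_sum)
          (auto simp: frechet_derivative_works[symmetric] intro!: differentiable_mult dYb dhb)
      from frechet_derivative_at[OF this, symmetric] show ?thesis
        by (simp add: lie_derivative_def)
    qed
    also have "\<dots> = (\<Sum>b\<in>Basis. (lie_derivative X Y p \<bullet> b) * ?h b p +
        (Y p \<bullet> b) * (\<Sum>c\<in>Basis. (X p \<bullet> c) * frechet_derivative (?h b) (at p) c))"
      by (simp add: lie_derivative_mult[OF dYb dhb] inner lie_derivative_basis[OF dhb])
    also have "\<dots> = ?h (lie_derivative X Y p) p +
      (\<Sum>b\<in>Basis. \<Sum>c\<in>Basis. (Y p \<bullet> b) * (X p \<bullet> c) * frechet_derivative (?h b) (at p) c)"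
      using lie_derivative_basis[OF dh, of "\<lambda>_. lie_derivative X Y p"]
      by (simp add: sum.distrib sum_distrib_left mult.assoc lie_derivative_def)
    finally show ?thesis .
  qed
  have sym: "(\<Sum>b\<in>Basis. \<Sum>c\<in>Basis. (Y p \<bullet> b) * (X p \<bullet> c) * frechet_derivative (?h b) (at p) c)
      = (\<Sum>b\<in>Basis. \<Sum>c\<in>Basis. (X p \<bullet> b) * (Y p \<bullet> c) * frechet_derivative (?h b) (at p) c)"
    by (subst sum.swap) (simp add: second_derivative_symmetric[OF h p] mult_ac)
  have "lie_derivative (lie_bracket X Y) h p = ?h (lie_derivative X Y p) p - ?h (lie_derivative Y X p) p"
    using linear_frechet_derivative[OF dh]
    by (simp add: lie_derivative_def[of "lie_bracket X Y"] lie_bracket_eq linear_diff)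
  then show ?thesis using sum[OF X Y] sum[OF Y X] sym by simp
qed

text \<open>Cartan's formula \<open>\<omega> [X, Y] = X (\<omega> Y) - Y (\<omega> X) - d\<omega> (X, Y)\<close> for the form
  \<open>\<omega> = du - (w + k) dz\<close>, with \<open>d\<omega> = - dw \<and> dz\<close>, on fields annihilated by \<open>\<omega>\<close>. With coordinate
  functions for \<open>u\<close>, \<open>w\<close>, \<open>z\<close> it controls brackets of sections of the flags; with the components of
  a map it controls the images of these brackets.\<close>

lemma contact_form_lie_bracket:
  fixes u w z :: "'a::euclidean_space \<Rightarrow> real"
  assumes X: "smooth_on U X" and Y: "smooth_on U Y" and p: "p \<in> U"
    and u: "smooth_on U u" and w: "smooth_on U w" and z: "smooth_on U z"
    and Xu: "\<And>x. x \<in> U \<Longrightarrow> lie_derivative X u x = (w x + k) * lie_derivative X z x"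
    and Yu: "\<And>x. x \<in> U \<Longrightarrow> lie_derivative Y u x = (w x + k) * lie_derivative Y z x"
  shows "lie_derivative (lie_bracket X Y) u p - (w p + k) * lie_derivative (lie_bracket X Y) z p
    = lie_derivative X w p * lie_derivative Y z p - lie_derivative Y w p * lie_derivative X z p"
proof -
  have twice: "lie_derivative X (lie_derivative Y u) p =
      lie_derivative X w p * lie_derivative Y z p + (w p + k) * lie_derivative X (lie_derivative Y z) p"
    if "smooth_on U Y" "\<And>x. x \<in> U \<Longrightarrow> lie_derivative Y u x = (w x + k) * lie_derivative Y z x" for X Y
  proof -
    have dw: "(\<lambda>x. w x + k) differentiable at p"
      using smooth_on_differentiable[OF w p] by simp
    have dz: "lie_derivative Y z differentiable at p"
      by (rule smooth_on_differentiable[OF smooth_on_lie_derivative[OF that(1) z] p])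
    have "lie_derivative X (lie_derivative Y u) p = lie_derivative X (\<lambda>x. (w x + k) * lie_derivative Y z x) p"
      using that(2) p w by (intro lie_derivative_cong[of U])
        (auto simp: smooth_on_open intro!: differentiable_mult dw dz)
    then show ?thesis
      using smooth_on_differentiable[OF w p] by (simp add: lie_derivative_mult[OF dw dz] lie_derivative_add)
  qed
  show ?thesis
    using twice[OF Y Yu] twice[OF X Xu]
    by (simp add: lie_derivative_lie_bracket[OF X Y _ p] u z algebra_simps)
qed

lemma lie_derivative_nth:
  fixes f :: "real^'n \<Rightarrow> real^'m"
  assumes "f differentiable (at p)"
  shows "lie_derivative X (\<lambda>x. f x $ m) p = lie_derivative X f p $ m"
  by (rule lie_derivative_bounded_linear[OF bounded_linear_vec_nth assms])

lemma lie_derivative_coordinate [simp]: "lie_derivative X (\<lambda>x. x $ m) p = X p $ m"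
  for p :: "real^'n"
  using lie_derivative_nth[of "\<lambda>x. x" p X m] by (simp add: lie_derivative_id)

lemma lie_bracket_nth:
  fixes X Y :: "real^'n \<Rightarrow> real^'n"
  assumes "X differentiable (at p)" "Y differentiable (at p)"
  shows "lie_bracket X Y p $ m = lie_derivative X (\<lambda>x. Y x $ m) p - lie_derivative Y (\<lambda>x. X x $ m) p"
  using assms by (simp add: lie_bracket_eq lie_derivative_nth)

text \<open>The values at \<open>p\<close> of the sections over a frame neighbourhood form a subspace that contains the
  frame.\<close>

lemma local_section_through:
  assumes C: "smooth_distribution k C" and v: "v \<in> C p"
  obtains U X where "p \<in> U" "local_section C U X" "X p = v"
proof -
  obtain U F where U: "open U" "p \<in> U" and F: "\<And>i. i < k \<Longrightarrow> smooth_on U (F i)"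
    and C: "\<And>q. q \<in> U \<Longrightarrow> C q = span ((\<lambda>i. F i q) ` {..<k})"
    using C unfolding smooth_distribution_def by metis
  let ?V = "{X p | X. local_section C U X}"
  have "subspace ?V"
  proof (rule subspaceI)
    have "local_section C U (\<lambda>x. 0)"
      using U C by (auto simp: local_section_def smooth_on_const span_zero)
    then show "0 \<in> ?V" by force
  next
    fix a b assume "a \<in> ?V" "b \<in> ?V"
    then obtain X Y where "local_section C U X" "local_section C U Y" "a = X p" "b = Y p" by blast
    moreover from this have "local_section C U (\<lambda>x. X x + Y x)"
      using C by (auto simp: local_section_def smooth_on_add span_add)
    ultimately show "a + b \<in> ?V" by force
  next
    fix r a assume "a \<in> ?V"
    then obtain X where "local_section C U X" "a = X p" by blast
    moreover from this have "local_section C U (\<lambda>x. r *\<^sub>R X x)"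
      using C U by (auto simp: local_section_def smooth_on_scaleR smooth_on_const span_scale)
    ultimately show "r *\<^sub>R a \<in> ?V" by force
  qed
  moreover have "(\<lambda>i. F i p) ` {..<k} \<subseteq> ?V"
  proof
    fix w assume "w \<in> (\<lambda>i. F i p) ` {..<k}"
    then obtain i where i: "i < k" "w = F i p" by auto
    then have "local_section C U (F i)"
      using C F by (auto simp: local_section_def intro: span_base)
    with i show "w \<in> ?V" by blast
  qed
  ultimately have "span ((\<lambda>i. F i p) ` {..<k}) \<subseteq> ?V"
    by (intro span_minimal)
  then show ?thesis using v C U that by blast
qed

section \<open>The derived flag as a chain of Pfaffian equations\<close>

lemma exhaust_9: "x = 1 \<or> x = 2 \<or> x = 3 \<or> x = 4 \<or> x = 5 \<or> x = 6 \<or> x = 7 \<or> x = 8 \<or> x = 9"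
  for x :: 9
proof (induct x)
  case (of_int z)
  then have "z = 0 \<or> z = 1 \<or> z = 2 \<or> z = 3 \<or> z = 4 \<or> z = 5 \<or> z = 6 \<or> z = 7 \<or> z = 8" by fastforce
  then show ?case by auto
qed

lemma forall_9: "(\<forall>i::9. P i) \<longleftrightarrow> P 1 \<and> P 2 \<and> P 3 \<and> P 4 \<and> P 5 \<and> P 6 \<and> P 7 \<and> P 8 \<and> P 9"
  by (metis exhaust_9)

text \<open>The forms \<open>\<theta>\<^sub>j = dx\<^sub>a - (x\<^sub>b + k) dx\<^sub>d\<close> with \<open>0 \<le> j \<le> 6\<close>. For \<open>j > 0\<close> the pair \<open>{b, d}\<close> of \<open>\<theta>\<^sub>j\<close>
  is the pair \<open>{a, d}\<close> of the preceding form. The constant \<open>c\<close> enters \<open>\<theta>\<^sub>0\<close> alone.\<close>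

definition pfaff_a :: "nat \<Rightarrow> 9" where "pfaff_a j = [8, 7, 6, 1, 4, 3, 2] ! j"
definition pfaff_b :: "nat \<Rightarrow> 9" where "pfaff_b j = [9, 8, 7, 6, 5, 4, 3] ! j"
definition pfaff_d :: "nat \<Rightarrow> 9" where "pfaff_d j = [5, 5, 5, 5, 1, 1, 1] ! j"
definition pfaff_k :: "real \<Rightarrow> nat \<Rightarrow> real" where "pfaff_k c j = [c, 1, 0, 0, 0, 0, 0] ! j"

lemmas pfaff_defs = pfaff_a_def pfaff_b_def pfaff_d_def pfaff_k_def

lemma less_7_cases:
  "j < 7 \<Longrightarrow> j = 0 \<or> j = 1 \<or> j = 2 \<or> j = 3 \<or> j = 4 \<or> j = 5 \<or> j = (6::nat)"
  by arith

text \<open>The common kernel of \<open>\<theta>\<^sub>j\<close> for \<open>i \<le> j \<le> 6\<close>.\<close>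

definition flag :: "real \<Rightarrow> nat \<Rightarrow> (real^9) distribution" where
  "flag c i p = {v. \<forall>j\<in>{i..<7}. v $ pfaff_a j = (p $ pfaff_b j + pfaff_k c j) * v $ pfaff_d j}"

text \<open>The total derivative on the space of jets of order three of a function \<open>x\<^sub>2\<close> of \<open>x\<^sub>1\<close>, the
  coordinates \<open>x\<^sub>3, x\<^sub>4, x\<^sub>5\<close> being the derivatives.\<close>

definition jet_field :: "real^9 \<Rightarrow> real^9" where
  "jet_field x = x$5 *\<^sub>R axis 4 1 + x$4 *\<^sub>R axis 3 1 + x$3 *\<^sub>R axis 2 1 + axis 1 1"

text \<open>A section of the \<open>i\<close>-th flag distribution on which \<open>dx\<^sub>d\<close>, for the form \<open>\<theta>\<^sub>i\<close>, has value one.\<close>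

definition flag_field :: "real \<Rightarrow> nat \<Rightarrow> real^9 \<Rightarrow> real^9" where
  "flag_field c i = (if i \<le> 3 then kappa2 c else jet_field)"

lemma all_from: "(\<forall>j\<in>{i..<7}. P j) \<longleftrightarrow>
   (i \<le> 0 \<longrightarrow> P 0) \<and> (i \<le> 1 \<longrightarrow> P 1) \<and> (i \<le> 2 \<longrightarrow> P 2) \<and> (i \<le> 3 \<longrightarrow> P 3) \<and> (i \<le> 4 \<longrightarrow> P 4)
   \<and> (i \<le> 5 \<longrightarrow> P 5) \<and> (i \<le> 6 \<longrightarrow> P (6::nat))"
  using less_7_cases by (auto simp: Ball_def) 

lemma flag_iff: "v \<in> flag c i p \<longleftrightarrow>
    (i \<le> 0 \<longrightarrow> v$8 = (p$9 + c) * v$5) \<and> (i \<le> 1 \<longrightarrow> v$7 = (p$8 + 1) * v$5) \<and>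
    (i \<le> 2 \<longrightarrow> v$6 = p$7 * v$5) \<and> (i \<le> 3 \<longrightarrow> v$1 = p$6 * v$5) \<and> (i \<le> 4 \<longrightarrow> v$4 = p$5 * v$1) \<and>
    (i \<le> 5 \<longrightarrow> v$3 = p$4 * v$1) \<and> (i \<le> 6 \<longrightarrow> v$2 = p$3 * v$1)"
  unfolding flag_def mem_Collect_eq all_from by (simp add: pfaff_defs)

lemma kappa2_nth [simp]:
  "kappa2 c x $ 9 = 0" "kappa2 c x $ 8 = x$9 + c" "kappa2 c x $ 7 = x$8 + 1" "kappa2 c x $ 6 = x$7"
  "kappa2 c x $ 5 = 1" "kappa2 c x $ 4 = x$6 * x$5" "kappa2 c x $ 3 = x$6 * x$4" "kappa2 c x $ 2 = x$6 * x$3"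
  "kappa2 c x $ 1 = x$6"
  by (simp_all add: kappa2_def axis_def)

lemma jet_field_nth [simp]:
  "jet_field x $ 9 = 0" "jet_field x $ 8 = 0" "jet_field x $ 7 = 0" "jet_field x $ 6 = 0"
  "jet_field x $ 5 = 0" "jet_field x $ 4 = x$5" "jet_field x $ 3 = x$4" "jet_field x $ 2 = x$3"
  "jet_field x $ 1 = 1"
  by (simp_all add: jet_field_def axis_def)

lemma flag_0: "flag c 0 = kumpera_ruiz c"
proof
  fix p
  have "v \<in> flag c 0 p \<longleftrightarrow> (\<exists>s t. v = s *\<^sub>R kappa1 p + t *\<^sub>R kappa2 c p)" for v
  proof
    assume "v \<in> flag c 0 p"
    then have "v = v$9 *\<^sub>R kappa1 p + v$5 *\<^sub>R kappa2 c p"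
      by (simp add: flag_iff vec_eq_iff forall_9 kappa1_def) (simp add: axis_def)
    then show "\<exists>s t. v = s *\<^sub>R kappa1 p + t *\<^sub>R kappa2 c p" by blast
  next
    assume "\<exists>s t. v = s *\<^sub>R kappa1 p + t *\<^sub>R kappa2 c p"
    then show "v \<in> flag c 0 p"
      by (auto simp: flag_iff kappa1_def axis_def)
  qed
  then show "flag c 0 p = kumpera_ruiz c p"
    unfolding kumpera_ruiz_def span_insert span_empty
    by (auto simp: algebra_simps)
qed

lemma subspace_flag: "subspace (flag c i p)"
  unfolding flag_def subspace_def by (auto simp: algebra_simps)

lemma flag_mono: "flag c i p \<subseteq> flag c (Suc i) p"
  by (auto simp: flag_def)

lemma flag_7: "flag c 7 p = UNIV"
  by (simp add: flag_def)

lemma axis_in_flag: "i < 7 \<Longrightarrow> axis (pfaff_b i) 1 \<in> flag c i p"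
  by (drule less_7_cases) (auto simp: flag_iff pfaff_b_def axis_def)

lemma flag_field_in_flag: "i < 7 \<Longrightarrow> flag_field c i p \<in> flag c i p"
  by (drule less_7_cases) (auto simp: flag_iff flag_field_def)

lemma flag_field_nth: "i < 7 \<Longrightarrow> flag_field c i p $ pfaff_d i = 1"
  by (drule less_7_cases) (auto simp: pfaff_d_def flag_field_def)

lemma pfaff_b_neq_d: "i < 7 \<Longrightarrow> pfaff_b i \<noteq> pfaff_d i"
  by (drule less_7_cases) (auto simp: pfaff_defs)

text \<open>On the kernel of the form preceding \<open>\<theta>\<^sub>j\<close>, the differentials of its \<open>x\<^sub>a\<close> and \<open>x\<^sub>d\<close> are
  proportional, so their exterior product vanishes there. Up to sign this product is \<open>d\<theta>\<^sub>j\<close>.\<close>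

lemma flag_integrable:
  assumes "u \<in> flag c i p" "v \<in> flag c i p" "i < j" "j < 7"
  shows "u $ pfaff_b j * v $ pfaff_d j = v $ pfaff_b j * u $ pfaff_d j"
  using less_7_cases[OF assms(4)] assms(3) assms(1,2)[unfolded flag_iff]
  by (elim disjE) (simp_all add: pfaff_defs)

lemma flag_bracket:
  assumes X: "local_section (flag c i) U X" and Y: "local_section (flag c i) U Y"
    and p: "p \<in> U" and j: "i \<le> j" "j < 7"
  shows "lie_bracket X Y p $ pfaff_a j - (p $ pfaff_b j + pfaff_k c j) * lie_bracket X Y p $ pfaff_d j
    = X p $ pfaff_b j * Y p $ pfaff_d j - Y p $ pfaff_b j * X p $ pfaff_d j"
proof -
  have "smooth_on U (\<lambda>x. x $ m)" for m :: 9
    using X by (intro smooth_on_vec_nth smooth_on_id) (auto simp: local_section_def smooth_on_open)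
  then show ?thesis
    using contact_form_lie_bracket[of U X Y p "\<lambda>x. x $ pfaff_a j" "\<lambda>x. x $ pfaff_b j" "\<lambda>x. x $ pfaff_d j" "pfaff_k c j"]
      assms by (simp add: local_section_def flag_def)
qed

lemma flag_bracket_Suc:
  assumes "local_section (flag c i) U X" "local_section (flag c i) U Y" "p \<in> U"
  shows "lie_bracket X Y p \<in> flag c (Suc i) p"
proof -
  have "lie_bracket X Y p $ pfaff_a j = (p $ pfaff_b j + pfaff_k c j) * lie_bracket X Y p $ pfaff_d j"
    if "Suc i \<le> j" "j < 7" for j
    using flag_bracket[OF assms, of j] flag_integrable[of "X p" c i p "Y p" j] that assms
    by (simp add: local_section_def)
  then show ?thesis by (simp add: flag_def)
qed

lemma smooth_on_kappa2: "open U \<Longrightarrow> smooth_on U (kappa2 c)"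
  unfolding kappa2_def[abs_def]
  by (intro smooth_on_add smooth_on_scaleR smooth_on_const smooth_on_vec_nth smooth_on_id)

lemma smooth_on_jet_field: "open U \<Longrightarrow> smooth_on U jet_field"
  unfolding jet_field_def[abs_def]
  by (intro smooth_on_add smooth_on_scaleR smooth_on_const smooth_on_vec_nth smooth_on_id)

lemma local_section_flag_field: "open U \<Longrightarrow> i < 7 \<Longrightarrow> local_section (flag c i) U (flag_field c i)"
  using flag_field_in_flag by (auto simp: local_section_def flag_field_def[abs_def] smooth_on_kappa2 smooth_on_jet_field)

lemma local_section_axis: "open U \<Longrightarrow> i < 7 \<Longrightarrow> local_section (flag c i) U (\<lambda>_. axis (pfaff_b i) 1)"
  using axis_in_flag by (auto simp: local_section_def smooth_on_const)

text \<open>A section of the next flag distribution that leaves the \<open>i\<close>-th one: the form \<open>\<theta>\<^sub>i\<close> takes the value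
  one on it.\<close>

definition flag_step :: "real \<Rightarrow> nat \<Rightarrow> real^9 \<Rightarrow> real^9" where
  "flag_step c i = lie_bracket (\<lambda>_. axis (pfaff_b i) 1) (flag_field c i)"

lemma flag_step_in_flag: "i < 7 \<Longrightarrow> flag_step c i p \<in> flag c (Suc i) p"
  unfolding flag_step_def
  by (intro flag_bracket_Suc[of c i UNIV] local_section_axis local_section_flag_field) auto

lemma flag_step_pfaff:
  assumes "i < 7"
  shows "flag_step c i p $ pfaff_a i - (p $ pfaff_b i + pfaff_k c i) * flag_step c i p $ pfaff_d i = 1"
  using flag_bracket[OF local_section_axis local_section_flag_field, of UNIV i p i c] assms pfaff_b_neq_d[OF assms]
  by (simp add: flag_step_def flag_field_nth) (simp add: axis_def)

lemma flag_step_notin_flag: "i < 7 \<Longrightarrow> flag_step c i p \<notin> flag c i p"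
  using flag_step_pfaff[of i c p] by (auto simp: flag_def intro!: bexI[of _ i])

lemma flag_Suc:
  assumes i: "i < 7"
  shows "flag c (Suc i) p = span (insert (flag_step c i p) (flag c i p))" (is "?l = ?r")
proof
  show "?r \<subseteq> ?l"
    using flag_step_in_flag[OF i] flag_mono subspace_flag by (intro span_minimal) auto
  show "?l \<subseteq> ?r"
  proof
    fix v assume v: "v \<in> ?l"
    \<comment> \<open>the value of \<open>\<theta>\<^sub>i\<close> on \<open>v\<close>, which the multiple of the step removes\<close>
    define s where "s = v $ pfaff_a i - (p $ pfaff_b i + pfaff_k c i) * v $ pfaff_d i"
    have "v - s *\<^sub>R flag_step c i p \<in> flag c (Suc i) p"
      using v flag_step_in_flag[OF i] subspace_flag by (blast intro: subspace_diff subspace_scale)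
    moreover have "(v - s *\<^sub>R flag_step c i p) $ pfaff_a i
        = (p $ pfaff_b i + pfaff_k c i) * (v - s *\<^sub>R flag_step c i p) $ pfaff_d i"
      using arg_cong[OF flag_step_pfaff[OF i, of c p], of "\<lambda>t. s * t"] by (simp add: s_def algebra_simps)
    moreover have "{i..<7} = insert i {Suc i..<7}" using i by auto
    ultimately have "v - s *\<^sub>R flag_step c i p \<in> flag c i p"
      by (simp add: flag_def)
    then show "v \<in> ?r" unfolding span_insert by (blast intro: span_base)
  qed
qed

lemma derived_flag_eq_Suc:
  assumes i: "i < 7"
  shows "derived (flag c i) p = flag c (Suc i) p"
proof
  show "derived (flag c i) p \<subseteq> flag c (Suc i) p"
    unfolding derived_def using flag_mono subspace_flag
    by (intro span_minimal) (auto intro: flag_bracket_Suc)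
  have "flag_step c i p \<in> {lie_bracket X Y p | X Y. \<exists>U. p \<in> U \<and> local_section (flag c i) U X \<and> local_section (flag c i) U Y}"
    unfolding flag_step_def using local_section_axis[of UNIV] local_section_flag_field[of UNIV] i by blast
  then show "flag c (Suc i) p \<subseteq> derived (flag c i) p"
    unfolding flag_Suc[OF i] derived_def by (intro span_mono) auto
qed

lemma derived_flag_kumpera_ruiz: "i \<le> 7 \<Longrightarrow> derived_flag (kumpera_ruiz c) i = flag c i"
  by (induction i) (auto simp: flag_0 derived_flag_eq_Suc)

text \<open>Each derivation adds exactly one dimension, and the last distribution is the whole space, so
  the ranks are counted downwards from nine.\<close>

lemma dim_flag: "i \<le> 7 \<Longrightarrow> dim (flag c i p) = i + 2"
proof (induction rule: inc_induct)
  case base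
  show ?case by (simp add: flag_7)
next
  case (step n)
  have "flag_step c n p \<notin> span (flag c n p)"
    using flag_step_notin_flag step subspace_flag by (metis span_eq_iff)
  then have "dim (flag c (Suc n) p) = dim (flag c n p) + 1"
    using step by (simp add: flag_Suc dim_insert)
  then show ?case using step by simp
qed

lemma goursat_kumpera_ruiz: "goursat (kumpera_ruiz c)"
proof -
  have eq: "(\<lambda>i::nat. (if i = 0 then kappa1 else kappa2 c) q) ` {..<2} = {kappa1 q, kappa2 c q}" for q
    by (auto simp: lessThan_nat_numeral lessThan_Suc)
  have dim: "dim (kumpera_ruiz c q) = 2" for q
    using dim_flag[of 0 c q] by (simp add: flag_0)
  have k1: "smooth_on UNIV kappa1"
    unfolding kappa1_def[abs_def] by (rule smooth_on_const) simp
  have "smooth_distribution 2 (kumpera_ruiz c)"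
    unfolding smooth_distribution_def
  proof (intro allI exI conjI ballI impI)
    show "smooth_on UNIV (if i = 0 then kappa1 else kappa2 c)" for i :: nat
      using k1 by (simp add: smooth_on_kappa2)
    show "kumpera_ruiz c q = span ((\<lambda>i::nat. (if i = 0 then kappa1 else kappa2 c) q) ` {..<2})" for q
      unfolding eq kumpera_ruiz_def ..
  qed (auto simp: dim)
  moreover have "dim (derived_flag (kumpera_ruiz c) i p) = i + 2" if "i \<le> 7" for i p
    using that by (simp add: derived_flag_kumpera_ruiz dim_flag)
  ultimately show ?thesis unfolding goursat_def by simp
qed

section \<open>The canonical subdistributions\<close>

text \<open>The span of the coordinate fields of indices \<open>9 - i, \<dots>, 9\<close>, which is the canonical
  subdistribution of index \<open>i\<close>.\<close>

definition characteristic :: "nat \<Rightarrow> (real^9) distribution" where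
  "characteristic i p = {v. \<forall>m\<in>{1..8-i}. v $ of_nat m = 0}"

lemma characteristic_iff: "v \<in> characteristic i p \<longleftrightarrow>
   (i \<le> 7 \<longrightarrow> v$1 = 0) \<and> (i \<le> 6 \<longrightarrow> v$2 = 0) \<and> (i \<le> 5 \<longrightarrow> v$3 = 0) \<and> (i \<le> 4 \<longrightarrow> v$4 = 0) \<and>
   (i \<le> 3 \<longrightarrow> v$5 = 0) \<and> (i \<le> 2 \<longrightarrow> v$6 = 0) \<and> (i \<le> 1 \<longrightarrow> v$7 = 0) \<and> (i \<le> 0 \<longrightarrow> v$8 = 0)"
proof -
  have "(\<forall>m\<in>{1..8-i}. P m) \<longleftrightarrow> (i \<le> 7 \<longrightarrow> P 1) \<and> (i \<le> 6 \<longrightarrow> P 2) \<and> (i \<le> 5 \<longrightarrow> P 3) \<and> (i \<le> 4 \<longrightarrow> P 4) \<and>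
   (i \<le> 3 \<longrightarrow> P 5) \<and> (i \<le> 2 \<longrightarrow> P 6) \<and> (i \<le> 1 \<longrightarrow> P 7) \<and> (i \<le> 0 \<longrightarrow> P 8)" (is "?l = ?r") for P
  proof
    assume *: ?l
    show ?r by (intro conjI impI; rule bspec[OF *]; simp)
  next
    assume *: ?r
    show ?l
    proof
      fix m assume m: "m \<in> {1..8-i}"
      then have "m = 1 \<or> m = 2 \<or> m = 3 \<or> m = 4 \<or> m = 5 \<or> m = 6 \<or> m = 7 \<or> m = 8"
        unfolding atLeastAtMost_iff by arith
      then show "P m" using * m by (elim disjE) simp_all
    qed
  qed
  then show ?thesis unfolding characteristic_def mem_Collect_eq by simp
qed

text \<open>Inside \<open>D\<^sup>(\<^sup>i\<^sup>)\<close> the canonical subdistribution is where the two differentials in \<open>d\<theta>\<close>, for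
  the form of index \<open>i + 1\<close>, both vanish: it consists of the Cauchy characteristics of \<open>D\<close> derived
  \<open>i + 1\<close> times. This intrinsic description gives both its uniqueness and its invariance.\<close>

lemma characteristic_eq_flag:
  assumes "i \<le> 5"
  shows "v \<in> characteristic i p \<longleftrightarrow> v \<in> flag c i p \<and> v $ pfaff_b (Suc i) = 0 \<and> v $ pfaff_d (Suc i) = 0"
proof -
  have "i = 0 \<or> i = 1 \<or> i = 2 \<or> i = 3 \<or> i = 4 \<or> i = 5" using assms by arith
  then show ?thesis
    unfolding characteristic_iff flag_iff by (elim disjE) (simp_all add: pfaff_defs, auto)
qed

lemma characteristic_pfaff:
  assumes "v \<in> characteristic i p" "i < j" "j < 7"
  shows "v $ pfaff_b j = 0 \<and> v $ pfaff_d j = 0"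
  using less_7_cases[OF assms(3)] assms(2) assms(1)[unfolded characteristic_iff]
  by (elim disjE) (simp_all add: pfaff_defs)

lemma characteristic_subset_flag: "i \<le> 5 \<Longrightarrow> i \<le> j \<Longrightarrow> characteristic i p \<subseteq> flag c j p"
  using characteristic_eq_flag[of i _ p c] by (auto simp: flag_def)

lemma axis_in_characteristic:
  "axis 9 1 \<in> characteristic i x" "i \<ge> 1 \<Longrightarrow> axis 8 1 \<in> characteristic i x"
  "i \<ge> 2 \<Longrightarrow> axis 7 1 \<in> characteristic i x" "i \<ge> 3 \<Longrightarrow> axis 6 1 \<in> characteristic i x"
  "i \<ge> 4 \<Longrightarrow> axis 5 1 \<in> characteristic i x" "i \<ge> 5 \<Longrightarrow> axis 4 1 \<in> characteristic i x"
  by (simp_all add: characteristic_iff axis_def)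

lemma subspace_characteristic: "subspace (characteristic i p)"
  unfolding characteristic_def subspace_def by auto

lemma characteristic_span:
  assumes "i \<le> 5"
  shows "characteristic i q = span ((\<lambda>l. axis (pfaff_b l) 1) ` {..<i+1})" "dim (characteristic i q) = i + 1"
proof -
  let ?A = "(\<lambda>l. axis (pfaff_b l) 1 :: real^9) ` {..<i+1}"
  have i: "i = 0 \<or> i = 1 \<or> i = 2 \<or> i = 3 \<or> i = 4 \<or> i = 5" using assms by arith
  have sub: "?A \<subseteq> Basis" by auto
  have "(\<forall>b\<in>Basis. b \<notin> ?A \<longrightarrow> v \<bullet> b = 0) \<longleftrightarrow> v \<in> characteristic i q" for v
  proof -
    have "(\<forall>b\<in>Basis. b \<notin> ?A \<longrightarrow> v \<bullet> b = 0) \<longleftrightarrow> (\<forall>m. axis m 1 \<notin> ?A \<longrightarrow> v $ m = 0)"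
      by (auto simp: Basis_vec_def inner_axis)
    also have "\<dots> \<longleftrightarrow> v \<in> characteristic i q"
      using i unfolding characteristic_iff forall_9
      by (elim disjE) (simp_all add: lessThan_nat_numeral lessThan_Suc axis_eq_axis pfaff_b_def)
    finally show ?thesis .
  qed
  then have characteristic: "characteristic i q = {v. \<forall>b\<in>Basis. b \<notin> ?A \<longrightarrow> v \<bullet> b = 0}" by blast
  show "characteristic i q = span ?A" unfolding characteristic span_substd_basis[OF sub] ..
  have "card ?A = i + 1"
    using i by (elim disjE) (simp_all add: lessThan_nat_numeral lessThan_Suc axis_eq_axis pfaff_b_def)
  then show "dim (characteristic i q) = i + 1"
    unfolding characteristic dim_substandard[OF sub] .
qed

lemma is_canonical_characteristic:
  assumes i: "i \<le> 5"
  shows "is_canonical_subdistribution (kumpera_ruiz c) i (characteristic i)"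
proof -
  have "smooth_distribution (i + 1) (characteristic i)"
    unfolding smooth_distribution_def
  proof (intro allI exI conjI ballI impI)
    show "smooth_on UNIV (\<lambda>_::real^9. axis (pfaff_b l) 1 :: real^9)" for l by (rule smooth_on_const) simp
    show "characteristic i q = span ((\<lambda>l. axis (pfaff_b l) 1) ` {..<i + 1})" for q by (rule characteristic_span(1)[OF i])
    show "dim (characteristic i q) = i + 1" for q by (rule characteristic_span(2)[OF i])
  qed auto
  moreover have "characteristic i p \<subseteq> flag c i p" for p
    using characteristic_eq_flag[OF i] by blast
  moreover have "involutive (characteristic i)"
    unfolding involutive_def bracket_subset_def
  proof (intro allI impI ballI, elim conjE)
    fix U X Y p
    assume X: "local_section (characteristic i) U X" and Y: "local_section (characteristic i) U Y" and p: "p \<in> U"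
    have zero: "lie_derivative X (\<lambda>x. Y x $ of_nat m) p = 0"
      if "local_section (characteristic i) U Y" "m \<in> {1..8-i}" for X Y m
    proof -
      have "lie_derivative X (\<lambda>x. Y x $ of_nat m) p = lie_derivative X (\<lambda>x. 0) p"
        using that p by (intro lie_derivative_cong[of U]) (auto simp: local_section_def characteristic_def smooth_on_open)
      then show ?thesis by simp
    qed
    have "X differentiable at p" "Y differentiable at p"
      using X Y p by (auto simp: local_section_def smooth_on_differentiable)
    then show "lie_bracket X Y p \<in> characteristic i p"
      using zero[OF X] zero[OF Y] by (simp add: characteristic_def lie_bracket_nth)
  qed
  moreover have "bracket_subset (characteristic i) (flag c (i + 1)) (flag c (i + 1))"
    unfolding bracket_subset_def
  proof (intro allI impI ballI, elim conjE)
    fix U X Y p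
    assume X: "local_section (characteristic i) U X" and Y: "local_section (flag c (i+1)) U Y" and p: "p \<in> U"
    have X': "local_section (flag c (i+1)) U X"
      using X characteristic_eq_flag[OF i] flag_mono[of c i] unfolding local_section_def Suc_eq_plus1[symmetric] by blast
    have "X p \<in> characteristic i p" using X p by (auto simp: local_section_def)
    then show "lie_bracket X Y p \<in> flag c (i+1) p"
      using flag_bracket[OF X' Y p] characteristic_pfaff[of "X p" i p] by (auto simp: flag_def)
  qed
  ultimately show ?thesis
    using i by (simp add: is_canonical_subdistribution_def derived_flag_kumpera_ruiz del: derived_flag.simps)
qed

text \<open>A section \<open>X\<close> of a competitor keeps \<open>D\<^sup>(\<^sup>i\<^sup>+\<^sup>1\<^sup>)\<close> stable, so \<open>d\<theta> (X, Y) = 0\<close> for the form of index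
  \<open>i + 1\<close> and all sections \<open>Y\<close>. The constant field \<open>\<partial>\<^sub>b\<close> and the flag field, taken as \<open>Y\<close>, force
  both differentials of \<open>d\<theta>\<close> to vanish on \<open>X\<close>. Equality follows by comparing ranks.\<close>

lemma is_canonical_unique:
  assumes i: "i \<le> 5" and C: "is_canonical_subdistribution (kumpera_ruiz c) i C"
  shows "C = characteristic i"
proof
  fix p
  have sd: "smooth_distribution (i + 1) C" and sub: "\<And>p. C p \<subseteq> flag c i p"
    and br: "bracket_subset C (flag c (Suc i)) (flag c (Suc i))"
    using C i by (simp_all add: is_canonical_subdistribution_def derived_flag_kumpera_ruiz del: derived_flag.simps)
  have "C p \<subseteq> characteristic i p"
  proof
    fix v assume v: "v \<in> C p"
    obtain U X where U: "p \<in> U" and X: "local_section C U X" and Xp: "X p = v"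
      by (rule local_section_through[OF sd v])
    have "open U" using X smooth_on_open by (auto simp: local_section_def)
    have X': "local_section (flag c (Suc i)) U X"
      using X sub flag_mono[of c i] unfolding local_section_def by blast
    have eq: "v $ pfaff_b (Suc i) * Y p $ pfaff_d (Suc i) = Y p $ pfaff_b (Suc i) * v $ pfaff_d (Suc i)"
      if Y: "local_section (flag c (Suc i)) U Y" for Y
    proof -
      have "lie_bracket X Y p \<in> flag c (Suc i) p"
        using br X Y U by (auto simp: bracket_subset_def)
      then show ?thesis
        using flag_bracket[OF X' Y U, of "Suc i"] i Xp by (simp add: flag_def)
    qed
    have si: "Suc i < 7" using i by simp
    have d: "v $ pfaff_d (Suc i) = 0"
      using eq[OF local_section_axis[OF \<open>open U\<close> si]] pfaff_b_neq_d[OF si] by (simp add: axis_def)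
    moreover have "v $ pfaff_b (Suc i) = 0"
      using eq[OF local_section_flag_field[OF \<open>open U\<close> si]] d by (simp add: flag_field_nth[OF si])
    ultimately show "v \<in> characteristic i p"
      using v sub characteristic_eq_flag[OF i] by blast
  qed
  moreover have "subspace (C p)" "dim (C p) = i + 1"
    using sd unfolding smooth_distribution_def by (metis subspace_span)+
  ultimately show "C p = characteristic i p"
    using characteristic_span(2)[OF i] subspace_characteristic by (intro subspace_dim_equal) auto
qed

lemma canonical_kumpera_ruiz:
  "i \<le> 5 \<Longrightarrow> canonical_subdistribution (kumpera_ruiz c) i = characteristic i"
  unfolding canonical_subdistribution_def
  using is_canonical_characteristic is_canonical_unique by (intro the_equality) auto

section \<open>The singularity type\<close>

text \<open>Straight lines realise all the vectors allowed by the equations.\<close>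

lemma tangent_space_coordinate_subspace:
  fixes q :: "real^'n"
  assumes q: "\<forall>m\<in>M. q $ m = 0"
  shows "tangent_space {x. \<forall>m\<in>M. x $ m = 0} q = {v. \<forall>m\<in>M. v $ m = 0}"
proof (intro set_eqI iffI)
  fix v assume "v \<in> tangent_space {x. \<forall>m\<in>M. x $ m = 0} q"
  then obtain c :: "real \<Rightarrow> real^'n" and e where e: "e > 0"
    and c: "c ` {-e<..<e} \<subseteq> {x. \<forall>m\<in>M. x $ m = 0}" "(c has_vector_derivative v) (at 0)"
    unfolding tangent_space_def by blast
  have "v $ m = 0" if m: "m \<in> M" for m
  proof -
    have "((\<lambda>t. c t $ m) has_vector_derivative v $ m) (at 0)"
      by (rule bounded_linear.has_vector_derivative[OF bounded_linear_vec_nth c(2)])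
    moreover have zero: "c t $ m = 0" if "t \<in> {-e<..<e}" for t
      using c(1) m that by blast
    have "((\<lambda>t. c t $ m) has_vector_derivative 0) (at 0)"
      by (rule has_vector_derivative_transform_within_open[where f = "\<lambda>t. 0" and S = "{-e<..<e}"])
        (use e zero in simp_all)
    ultimately show ?thesis by (rule vector_derivative_unique_at)
  qed
  then show "v \<in> {v. \<forall>m\<in>M. v $ m = 0}" by blast
next
  fix v :: "real^'n" assume v: "v \<in> {v. \<forall>m\<in>M. v $ m = 0}"
  have "smooth_on {-1<..<1} (\<lambda>t::real. q + t *\<^sub>R v)"
    by (intro smooth_on_add smooth_on_scaleR smooth_on_const smooth_on_id) auto
  moreover have "((\<lambda>t::real. q + t *\<^sub>R v) has_vector_derivative v) (at 0)"
    by (auto intro!: derivative_eq_intros)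
  ultimately show "v \<in> tangent_space {x. \<forall>m\<in>M. x $ m = 0} q"
    unfolding tangent_space_def using q v
    by (intro CollectI exI[of _ "\<lambda>t. q + t *\<^sub>R v"] exI[of _ 1]) auto
qed

lemma kappa2_in_flag: "kappa2 c q \<in> flag c i q"
  by (simp add: flag_iff)

text \<open>When \<open>i \<le> 4\<close> and \<open>i \<noteq> 3\<close>, the flag field has a constant coordinate one where the next canonical
  subdistribution has zero. For \<open>i = 3\<close> the only obstruction is the coordinate \<open>x\<^sub>6\<close> of \<open>kappa2\<close>.\<close>

lemma singular_locus_0:
  "singular_locus (kumpera_ruiz c) i 0 = (if i = 3 then {q. q $ 6 = 0} else {})"
proof (cases "i \<le> 4")
  case True
  have "singular_locus (kumpera_ruiz c) i 0 = {q. flag c i q = characteristic (Suc i) q}"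
    using True by (simp add: canonical_kumpera_ruiz derived_flag_kumpera_ruiz)
  moreover have "flag c i q \<noteq> characteristic (Suc i) q" if "i \<noteq> 3" for q
    using True that flag_field_in_flag[of i c q] by (auto simp: flag_field_def characteristic_iff split: if_splits)
  moreover have "flag c 3 q = characteristic 4 q \<longleftrightarrow> q $ 6 = 0" for q
  proof
    assume "flag c 3 q = characteristic 4 q"
    then have "kappa2 c q \<in> characteristic 4 q" using kappa2_in_flag[of c q 3] by simp
    then show "q $ 6 = 0" by (simp add: characteristic_iff)
  qed (auto simp: flag_iff characteristic_iff)
  ultimately show ?thesis by auto
qed simp

lemma singular_locus_empty: "i \<noteq> 3 \<Longrightarrow> singular_locus (kumpera_ruiz c) i j = {}"
proof (induction j)
  case 0
  then show ?case by (simp only: singular_locus_0) simp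
qed simp

text \<open>Along \<open>x\<^sub>6 = 0\<close> the field \<open>kappa2\<close>, whose coordinate of index six is \<open>x\<^sub>7\<close>, is tangent exactly when
  \<open>x\<^sub>7 = 0\<close>.\<close>

lemma singular_locus_1: "singular_locus (kumpera_ruiz c) 3 1 = {q. q $ 6 = 0 \<and> q $ 7 = 0}"
proof -
  have tangent: "tangent_space {q::real^9. q $ 6 = 0} q = {v. v $ 6 = 0}" if "q $ 6 = 0" for q
    using tangent_space_coordinate_subspace[of "{6}" q] that by simp
  have meet: "flag c 2 q \<inter> {v. v $ 6 = 0} \<noteq> characteristic 2 q \<longleftrightarrow> q $ 7 = 0" if "q $ 6 = 0" for q
  proof
    assume "flag c 2 q \<inter> {v. v $ 6 = 0} \<noteq> characteristic 2 q"
    then show "q $ 7 = 0" using that by (auto simp: flag_iff characteristic_iff)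
  next
    assume "q $ 7 = 0"
    then have "kappa2 c q \<in> flag c 2 q \<inter> {v. v $ 6 = 0}" "kappa2 c q \<notin> characteristic 2 q"
      by (auto simp: kappa2_in_flag characteristic_iff)
    then show "flag c 2 q \<inter> {v. v $ 6 = 0} \<noteq> characteristic 2 q" by blast
  qed
  have locus: "singular_locus (kumpera_ruiz c) 3 1 =
      {q \<in> {q. q $ 6 = 0}. flag c 2 q \<inter> tangent_space {q. q $ 6 = 0} q \<noteq> characteristic 2 q}"
    unfolding One_nat_def singular_locus.simps(2) singular_locus_0
    by (simp add: canonical_kumpera_ruiz derived_flag_kumpera_ruiz)
  show ?thesis
  proof (intro set_eqI)
    fix q
    show "q \<in> singular_locus (kumpera_ruiz c) 3 1 \<longleftrightarrow> q \<in> {q. q $ 6 = 0 \<and> q $ 7 = 0}"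
      unfolding locus mem_Collect_eq by (cases "q $ 6 = 0") (simp_all only: tangent meet simp_thms)
  qed
qed

text \<open>The constant one added to \<open>x\<^sub>8\<close> in \<open>\<theta>\<^sub>1\<close> makes \<open>kappa2\<close> transverse to \<open>x\<^sub>7 = 0\<close> at zero.\<close>

lemma zero_notin_singular_locus_2: "0 \<notin> singular_locus (kumpera_ruiz c) 3 2"
proof -
  have "tangent_space {q::real^9. q $ 6 = 0 \<and> q $ 7 = 0} 0 = {v. v $ 6 = 0 \<and> v $ 7 = 0}"
    using tangent_space_coordinate_subspace[of "{6, 7}" "0 :: real^9"] by simp
  moreover have "flag c 1 0 \<inter> {v. v $ 6 = 0 \<and> v $ 7 = 0} = characteristic 1 0"
    by (auto simp: flag_iff characteristic_iff)
  ultimately show ?thesis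
    using singular_locus_1[of c] by (simp add: numeral_2_eq_2 canonical_kumpera_ruiz derived_flag_kumpera_ruiz del: derived_flag.simps)
qed

lemma zero_in_singular_locus_iff:
  "0 \<in> singular_locus (kumpera_ruiz c) n j \<longleftrightarrow> n = 3 \<and> j \<le> 1"
proof (cases "n = 3")
  case True
  have "0 \<notin> singular_locus (kumpera_ruiz c) 3 (j + 2)" for j
  proof (induction j)
    case 0
    show ?case using zero_notin_singular_locus_2 unfolding add_0 .
  next
    case (Suc j)
    then show ?case unfolding add_Suc singular_locus.simps(2) by (auto simp del: singular_locus.simps)
  qed
  then have "0 \<notin> singular_locus (kumpera_ruiz c) 3 j" if "j \<ge> 2"
    using that by (metis le_add_diff_inverse2)
  moreover have "0 \<in> singular_locus (kumpera_ruiz c) 3 j" if "j \<le> 1"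
  proof -
    have "j = 0 \<or> j = 1" using that by arith
    then show ?thesis
      using singular_locus_0[of c 3] singular_locus_1[of c] by (elim disjE) (simp_all del: singular_locus.simps)
  qed
  ultimately show ?thesis using True by fastforce
qed (simp add: singular_locus_empty)

lemma singularity_letter_zero:
  "singularity_letter (kumpera_ruiz c) 0 i = (if i = 3 then \<aa> 1 else if i = 2 then \<aa> 2 else \<aa> 0)"
proof -
  have "(THE j. i + j = 3 \<and> j \<le> 1) = 3 - i" if "i = 2 \<or> i = 3"
    using that by (intro the_equality) auto
  moreover have "(\<exists>j. i + j = 3 \<and> j \<le> 1) \<longleftrightarrow> i = 2 \<or> i = 3" by presburger
  ultimately show ?thesis
    unfolding singularity_letter_def zero_in_singular_locus_iff by auto
qed

lemma singularity_type_zero: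
  "singularity_type (kumpera_ruiz c) 0 = [\<aa> 0, \<aa> 0, \<aa> 1, \<aa> 2, \<aa> 0, \<aa> 0]"
  by (simp add: singularity_type_def singularity_letter_zero upt_rec)

section \<open>Maps respecting the flags\<close>

lemma parallel_imp_det_zero:
  fixes a b :: real
  assumes "a * q = p * b" "a * s = r * b" "\<not> (a = 0 \<and> b = 0)"
  shows "p * s - r * q = 0"
proof -
  have "a * (p * s - r * q) = p * (a * s) - r * (a * q)" by (simp add: algebra_simps)
  also have "\<dots> = 0" by (simp add: assms(1,2))
  finally have "a * (p * s - r * q) = 0" .
  moreover have "b * (p * s - r * q) = (p * b) * s - (r * b) * q" by (simp add: algebra_simps)
  then have "b * (p * s - r * q) = 0" by (simp add: assms(1,2)[symmetric])
  ultimately show ?thesis using assms(3) by auto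
qed

text \<open>Smooth maps with injective derivatives that carry one normal form into the other; as the ranks
  agree, the image of each plane is the whole plane of the target.\<close>

locale flag_map =
  fixes c c' :: real and U :: "(real^9) set" and f :: "real^9 \<Rightarrow> real^9"
  assumes smooth: "smooth_on U f"
    and inj: "x \<in> U \<Longrightarrow> inj (frechet_derivative f (at x))"
    and kumpera_ruiz: "x \<in> U \<Longrightarrow> v \<in> flag c 0 x \<Longrightarrow> frechet_derivative f (at x) v \<in> flag c' 0 (f x)"
begin

lemma open_domain: "open U"
  using smooth by (rule smooth_on_open)

lemma linear_derivative: "x \<in> U \<Longrightarrow> linear (frechet_derivative f (at x))"
  using smooth smooth_on_differentiable by (blast intro: linear_frechet_derivative)

lemma smooth_component: "smooth_on U (\<lambda>x. f x $ m)"
  using smooth by (rule smooth_on_vec_nth)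

lemma lie_derivative_component:
  "x \<in> U \<Longrightarrow> lie_derivative X (\<lambda>x. f x $ m) x = frechet_derivative f (at x) (X x) $ m"
  using lie_derivative_nth[OF smooth_on_differentiable[OF smooth], of x X m] by (simp add: lie_derivative_def)

text \<open>Cartan's formula for the pullback of \<open>\<theta>\<^sub>j\<close>, whose differential is the pullback of \<open>d\<theta>\<^sub>j\<close>.\<close>

lemma pushforward_bracket:
  assumes flag: "\<And>x v. x \<in> U \<Longrightarrow> v \<in> flag c i x \<Longrightarrow> frechet_derivative f (at x) v \<in> flag c' i (f x)"
    and X: "local_section (flag c i) U X" and Y: "local_section (flag c i) U Y"
    and x: "x \<in> U" and j: "i \<le> j" "j < 7"
  defines "F \<equiv> frechet_derivative f (at x)"
  shows "F (lie_bracket X Y x) $ pfaff_a j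
      - (f x $ pfaff_b j + pfaff_k c' j) * F (lie_bracket X Y x) $ pfaff_d j
    = F (X x) $ pfaff_b j * F (Y x) $ pfaff_d j - F (Y x) $ pfaff_b j * F (X x) $ pfaff_d j"
proof -
  have rel: "lie_derivative Z (\<lambda>x. f x $ pfaff_a j) y =
      (f y $ pfaff_b j + pfaff_k c' j) * lie_derivative Z (\<lambda>x. f x $ pfaff_d j) y"
    if "local_section (flag c i) U Z" "y \<in> U" for Z y
    using flag[of y "Z y"] that j by (simp add: lie_derivative_component local_section_def flag_def)
  have "smooth_on U X" "smooth_on U Y" using X Y by (simp_all add: local_section_def)
  from contact_form_lie_bracket[OF this x smooth_component smooth_component smooth_component rel[OF X] rel[OF Y]]
  show ?thesis by (simp add: lie_derivative_component x F_def)
qed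

text \<open>If \<open>f\<close> respects \<open>D\<^sup>(\<^sup>i\<^sup>)\<close>, then for \<open>j > i\<close> the right-hand side of the pushforward formula
  vanishes, as \<open>d\<theta>\<^sub>j\<close> does on the target distribution. So brackets of sections land in the derived
  distribution.\<close>

lemma maps_flag:
  "i \<le> 7 \<Longrightarrow> x \<in> U \<Longrightarrow> v \<in> flag c i x \<Longrightarrow> frechet_derivative f (at x) v \<in> flag c' i (f x)"
proof (induction i arbitrary: x v)
  case 0
  then show ?case by (simp add: kumpera_ruiz)
next
  case (Suc i)
  let ?F = "frechet_derivative f (at x)" and ?E = "\<lambda>_. axis (pfaff_b i) 1" and ?Z = "flag_field c i"
  have i: "i < 7" and U: "open U" using Suc.prems smooth by (auto simp: smooth_on_open)
  have flag: "frechet_derivative f (at x) v \<in> flag c' i (f x)" if "x \<in> U" "v \<in> flag c i x" for x v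
    using Suc.IH that i by simp
  have "?F (flag_step c i x) \<in> flag c' (Suc i) (f x)"
  proof -
    have "?F (flag_step c i x) $ pfaff_a j = (f x $ pfaff_b j + pfaff_k c' j) * ?F (flag_step c i x) $ pfaff_d j"
      if "Suc i \<le> j" "j < 7" for j
      using pushforward_bracket[OF flag local_section_axis[OF U i] local_section_flag_field[OF U i] Suc.prems(2), of j]
        flag_integrable[OF flag[OF Suc.prems(2) axis_in_flag[OF i]] flag[OF Suc.prems(2) flag_field_in_flag[OF i]], of j] that
      by (simp add: flag_step_def)
    then show ?thesis by (simp add: flag_def)
  qed
  moreover have "?F ` flag c i x \<subseteq> flag c' (Suc i) (f x)"
    using flag[OF Suc.prems(2)] flag_mono by blast
  ultimately have "insert (flag_step c i x) (flag c i x) \<subseteq> ?F -` flag c' (Suc i) (f x)"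
    by blast
  moreover have "subspace (?F -` flag c' (Suc i) (f x))"
    using linear_derivative[OF Suc.prems(2)] subspace_flag by (rule linear_subspace_vimage)
  ultimately have "span (insert (flag_step c i x) (flag c i x)) \<subseteq> ?F -` flag c' (Suc i) (f x)"
    by (rule span_minimal)
  then show ?case using Suc.prems(3) unfolding flag_Suc[OF i] by blast
qed

lemma dim_image:
  assumes "x \<in> U" "frechet_derivative f (at x) ` S \<subseteq> T"
  shows "dim S \<le> dim T"
proof -
  have "dim (frechet_derivative f (at x) ` S) = dim S"
    using linear_derivative inj assms(1) by (intro dim_image_eq) (auto intro: inj_on_subset)
  then show ?thesis using dim_subset[OF assms(2)] by simp
qed

text \<open>The image of a characteristic vector is \<open>d\<theta>\<close>-orthogonal to the image of \<open>D\<^sup>(\<^sup>i\<^sup>+\<^sup>1\<^sup>)\<close>, for the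
  form \<open>\<theta>\<close> of index \<open>i + 1\<close>. If one of the two differentials in \<open>d\<theta>\<close> were nonzero on it, then
  \<open>d\<theta>\<close> would vanish on that whole image; brackets would then stay in \<open>D\<^sup>(\<^sup>i\<^sup>+\<^sup>1\<^sup>)\<close> of the target,
  and the larger space \<open>D\<^sup>(\<^sup>i\<^sup>+\<^sup>2\<^sup>)\<close> would be mapped injectively into it.\<close>

lemma maps_characteristic:
  assumes i: "i \<le> 5" and x: "x \<in> U" and v: "v \<in> characteristic i x"
  shows "frechet_derivative f (at x) v \<in> characteristic i (f x)"
proof -
  let ?n = "Suc i" and ?F = "frechet_derivative f (at x)"
  let ?b = "pfaff_b ?n" and ?d = "pfaff_d ?n"
  let ?E = "\<lambda>_. axis ?b 1" and ?Z = "flag_field c ?n"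
  have n: "?n < 7" and U: "open U" using i smooth by (auto simp: smooth_on_open)
  have flag: "frechet_derivative f (at x) v \<in> flag c' ?n (f x)" if "x \<in> U" "v \<in> flag c ?n x" for x v
    using maps_flag that n by simp
  have vC: "local_section (characteristic i) U (\<lambda>_. v)"
    using v U by (auto simp: local_section_def characteristic_def smooth_on_const)
  then have V: "local_section (flag c ?n) U (\<lambda>_. v)"
    using characteristic_subset_flag[OF i] unfolding local_section_def by (meson Suc_leD le_refl le_SucI subsetD)
  have parallel: "?F v $ ?b * ?F (Y x) $ ?d = ?F (Y x) $ ?b * ?F v $ ?d"
    if Y: "local_section (flag c ?n) U Y" for Y
  proof -
    have "bracket_subset (characteristic i) (flag c ?n) (flag c ?n)"
      using is_canonical_characteristic[OF i, of c] i
      by (simp add: is_canonical_subdistribution_def derived_flag_kumpera_ruiz del: derived_flag.simps)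
    then have "lie_bracket (\<lambda>_. v) Y x \<in> flag c ?n x"
      using vC Y x unfolding bracket_subset_def by blast
    from flag[OF x this] show ?thesis
      using pushforward_bracket[OF flag V Y x, of ?n] n by (simp add: flag_def)
  qed
  have "?F v $ ?b = 0 \<and> ?F v $ ?d = 0"
  proof (rule ccontr)
    assume nz: "\<not> (?F v $ ?b = 0 \<and> ?F v $ ?d = 0)"
    \<comment> \<open>the images of the two generating fields are proportional to that of \<open>v\<close>, hence to each other\<close>
    have det: "?F (?E x) $ ?b * ?F (?Z x) $ ?d - ?F (?Z x) $ ?b * ?F (?E x) $ ?d = 0"
      by (rule parallel_imp_det_zero[OF parallel[OF local_section_axis[OF U n]]
            parallel[OF local_section_flag_field[OF U n]] nz])
    have "?F (flag_step c ?n x) $ pfaff_a j = (f x $ pfaff_b j + pfaff_k c' j) * ?F (flag_step c ?n x) $ pfaff_d j"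
      if "?n \<le> j" "j < 7" for j
    proof (cases "j = ?n")
      case True
      then show ?thesis
        using pushforward_bracket[OF flag local_section_axis[OF U n] local_section_flag_field[OF U n] x, of ?n] n det
        by (simp add: flag_step_def)
    next
      case False
      then show ?thesis
        using maps_flag[OF _ x flag_step_in_flag[OF n, of c x]] n that by (simp add: flag_def)
    qed
    then have "?F (flag_step c ?n x) \<in> flag c' ?n (f x)" by (simp add: flag_def)
    moreover have "?F ` flag c ?n x \<subseteq> flag c' ?n (f x)"
      using flag[OF x] by blast
    ultimately have "insert (flag_step c ?n x) (flag c ?n x) \<subseteq> ?F -` flag c' ?n (f x)"
      by blast
    moreover have "subspace (?F -` flag c' ?n (f x))"
      using linear_derivative[OF x] subspace_flag by (rule linear_subspace_vimage)
    ultimately have "span (insert (flag_step c ?n x) (flag c ?n x)) \<subseteq> ?F -` flag c' ?n (f x)"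
      by (rule span_minimal)
    then have "?F ` flag c (Suc ?n) x \<subseteq> flag c' ?n (f x)"
      unfolding flag_Suc[OF n] by blast
    from dim_image[OF x this] show False using n by (simp add: dim_flag)
  qed
  moreover have "?F v \<in> flag c' i (f x)"
    using v i characteristic_subset_flag[OF i order_refl, of x c] by (intro maps_flag x) auto
  ultimately show ?thesis using characteristic_eq_flag[OF i] by blast
qed

lemma lie_derivative_characteristic:
  assumes "i \<le> 5" "m \<in> {1..8-i}" "X x \<in> characteristic i x" "x \<in> U"
  shows "lie_derivative X (\<lambda>x. f x $ of_nat m) x = 0"
  using maps_characteristic[of i x "X x"] assms by (simp add: lie_derivative_component characteristic_def)

text \<open>Since \<open>f\<close> respects the canonical subdistributions, \<open>f\<^sub>1\<close> depends on \<open>x\<^sub>1, x\<^sub>2, x\<^sub>3\<close> only, \<open>f\<^sub>4\<close> on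
  \<open>x\<^sub>1, \<dots>, x\<^sub>4\<close> and \<open>f\<^sub>5\<close> on \<open>x\<^sub>1, \<dots>, x\<^sub>5\<close>.\<close>

lemma component_1: "X x \<in> characteristic 5 x \<Longrightarrow> x \<in> U \<Longrightarrow> lie_derivative X (\<lambda>x. f x $ 1) x = 0"
  using lie_derivative_characteristic[of 5 1] by simp

lemma component_4: "X x \<in> characteristic 4 x \<Longrightarrow> x \<in> U \<Longrightarrow> lie_derivative X (\<lambda>x. f x $ 4) x = 0"
  using lie_derivative_characteristic[of 4 4] by simp

lemma component_5: "X x \<in> characteristic 3 x \<Longrightarrow> x \<in> U \<Longrightarrow> lie_derivative X (\<lambda>x. f x $ 5) x = 0"
  using lie_derivative_characteristic[of 3 5] by simp

text \<open>Otherwise the image of the jet field would lie in the canonical subdistribution of index four,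
  which already contains the image of the one at \<open>x\<close>; six dimensions would fit into five.\<close>

lemma lie_derivative_jet_field_ne_0:
  assumes x: "x \<in> U"
  shows "lie_derivative jet_field (\<lambda>x. f x $ 1) x \<noteq> 0"
proof
  let ?F = "frechet_derivative f (at x)"
  assume "lie_derivative jet_field (\<lambda>x. f x $ 1) x = 0"
  then have 1: "?F (jet_field x) $ 1 = 0" using x by (simp add: lie_derivative_component)
  have "?F (jet_field x) \<in> flag c' 4 (f x)"
    using x by (intro maps_flag) (simp_all add: flag_iff)
  with 1 have "?F (jet_field x) \<in> characteristic 4 (f x)"
    by (simp add: flag_iff characteristic_iff)
  moreover have "?F ` characteristic 4 x \<subseteq> characteristic 4 (f x)"
    using maps_characteristic[of 4 x] x by auto
  ultimately have "?F ` insert (jet_field x) (characteristic 4 x) \<subseteq> characteristic 4 (f x)" by blast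
  from dim_image[OF x this] have "dim (insert (jet_field x) (characteristic 4 x)) \<le> 5"
    by (simp add: characteristic_span(2))
  moreover have "jet_field x \<notin> span (characteristic 4 x)"
    using subspace_characteristic[of 4 x] by (simp add: span_eq_iff[THEN iffD2] characteristic_iff)
  ultimately show False by (simp add: dim_insert characteristic_span(2))
qed

end

section \<open>The two normal forms are not equivalent\<close>

text \<open>Stated as a relation, so that an identity between functions on an open set is differentiated by
  composing the rules along its two sides.\<close>

definition has_lie_derivative ::
    "('a::euclidean_space \<Rightarrow> 'a) \<Rightarrow> 'a set \<Rightarrow> ('a \<Rightarrow> real) \<Rightarrow> ('a \<Rightarrow> real) \<Rightarrow> bool" where
  "has_lie_derivative X U h h' \<longleftrightarrow> smooth_on U h \<and> (\<forall>x\<in>U. lie_derivative X h x = h' x)"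

lemma has_lie_derivative_mult:
  "has_lie_derivative X U f f' \<Longrightarrow> has_lie_derivative X U g g' \<Longrightarrow>
    has_lie_derivative X U (\<lambda>x. f x * g x) (\<lambda>x. f' x * g x + f x * g' x)"
  by (simp add: has_lie_derivative_def smooth_on_mult
      lie_derivative_mult[OF smooth_on_differentiable[of U] smooth_on_differentiable[of U]])

lemma has_lie_derivative_add:
  "has_lie_derivative X U f f' \<Longrightarrow> has_lie_derivative X U g g' \<Longrightarrow>
    has_lie_derivative X U (\<lambda>x. f x + g x) (\<lambda>x. f' x + g' x)"
  by (simp add: has_lie_derivative_def smooth_on_add
      lie_derivative_add[OF smooth_on_differentiable[of U] smooth_on_differentiable[of U]])

lemma has_lie_derivative_const: "open U \<Longrightarrow> has_lie_derivative X U (\<lambda>x. r) (\<lambda>x. 0)"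
  by (simp add: has_lie_derivative_def smooth_on_const)

lemma has_lie_derivative_unique:
  assumes "has_lie_derivative X U f f'" "has_lie_derivative X U g g'"
    and "\<And>x. x \<in> U \<Longrightarrow> f x = g x" "x \<in> U"
  shows "f' x = g' x"
  using assms lie_derivative_cong[of U x f g X] smooth_on_open[of U f] smooth_on_differentiable[of U f x]
  by (simp add: has_lie_derivative_def)

lemma lie_derivative_eq_0:
  fixes h :: "'a::euclidean_space \<Rightarrow> real"
  assumes "open U" "x \<in> U" "\<And>x. x \<in> U \<Longrightarrow> h x = 0"
  shows "lie_derivative X h x = 0"
  using lie_derivative_cong[of U x "\<lambda>_. 0" h X] assms by simp

lemma lie_derivative_const_commute:
  fixes h :: "'a::euclidean_space \<Rightarrow> real"
  assumes "smooth_on U h" "x \<in> U"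
  shows "lie_derivative (\<lambda>_. u) (lie_derivative (\<lambda>_. v) h) x
    = lie_derivative (\<lambda>_. v) (lie_derivative (\<lambda>_. u) h) x"
  using second_derivative_symmetric[OF assms] by (simp add: lie_derivative_def[abs_def])

lemma lie_bracket_axis_jet_field:
  "lie_bracket (\<lambda>_. axis k 1) jet_field =
    (\<lambda>_. (if k = 5 then axis 4 1 else if k = 4 then axis 3 1 else if k = 3 then axis 2 1 else 0))"
proof
  fix p
  have d: "jet_field differentiable at p"
    using smooth_on_differentiable[OF smooth_on_jet_field[of UNIV]] by simp
  show "lie_bracket (\<lambda>_. axis k 1) jet_field p =
      (if k = 5 then axis 4 1 else if k = 4 then axis 3 1 else if k = 3 then axis 2 1 else 0)"
    unfolding vec_eq_iff forall_9 by (simp add: lie_bracket_nth d) (simp add: axis_def)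
qed

lemma lie_derivative_axis_jet_field:
  fixes h :: "real^9 \<Rightarrow> real"
  assumes "smooth_on U h" "x \<in> U"
  shows "lie_derivative (\<lambda>_. axis k 1) (lie_derivative jet_field h) x =
    lie_derivative jet_field (lie_derivative (\<lambda>_. axis k 1) h) x
    + lie_derivative (lie_bracket (\<lambda>_. axis k 1) jet_field) h x"
  using lie_derivative_lie_bracket[OF smooth_on_const smooth_on_jet_field assms] assms
  by (simp add: smooth_on_open)

context flag_map
begin

lemma lie_derivative_jet_1_axis_5:
  assumes x: "x \<in> U"
  shows "lie_derivative (\<lambda>_. axis 5 1) (lie_derivative jet_field (\<lambda>x. f x $ 1)) x = 0"
  unfolding lie_derivative_axis_jet_field[OF smooth_component x] lie_bracket_axis_jet_field using x
  by (simp add: lie_derivative_eq_0[OF open_domain] component_1 axis_in_characteristic)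

lemma lie_derivative_jet_1_axis_7:
  assumes x: "x \<in> U"
  shows "lie_derivative (\<lambda>_. axis 7 1) (lie_derivative jet_field (\<lambda>x. f x $ 1)) x = 0"
  unfolding lie_derivative_axis_jet_field[OF smooth_component x] lie_bracket_axis_jet_field using x
  by (simp add: lie_derivative_eq_0[OF open_domain] component_1 axis_in_characteristic
      lie_derivative_component linear_derivative linear_0)

text \<open>The component \<open>f\<^sub>5\<close> is affine in \<open>x\<^sub>5\<close>. Write \<open>W\<close> for the jet field. The form \<open>\<theta>\<^sub>4\<close> gives
  \<open>W f\<^sub>4 = f\<^sub>5 * W f\<^sub>1\<close>, where \<open>f\<^sub>4\<close> and \<open>W f\<^sub>1\<close> do not depend on \<open>x\<^sub>5\<close>. As \<open>[\<partial>\<^sub>5, W] = \<partial>\<^sub>4\<close>, one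
  derivative along \<open>x\<^sub>5\<close> leaves \<open>\<partial>\<^sub>4 f\<^sub>4 = \<partial>\<^sub>5 f\<^sub>5 * W f\<^sub>1\<close>, and a second one leaves
  \<open>0 = \<partial>\<^sub>5 \<partial>\<^sub>5 f\<^sub>5 * W f\<^sub>1\<close>.\<close>

lemma component_5_affine:
  assumes x: "x \<in> U"
  shows "lie_derivative (\<lambda>_. axis 5 1) (lie_derivative (\<lambda>_. axis 5 1) (\<lambda>x. f x $ 5)) x = 0"
proof -
  let ?f = "\<lambda>m x. f x $ m" and ?E = "\<lambda>k (_::real^9). axis k 1 :: real^9"
  define \<alpha> where "\<alpha> = lie_derivative jet_field (?f 1)"
  have sE: "smooth_on U (?E k)" for k using open_domain by (rule smooth_on_const)
  have s\<alpha>: "smooth_on U \<alpha>"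
    unfolding \<alpha>_def by (intro smooth_on_lie_derivative smooth_on_jet_field open_domain smooth_component)
  have E5\<alpha>: "has_lie_derivative (?E 5) U \<alpha> (\<lambda>_. 0)"
    using s\<alpha> lie_derivative_jet_1_axis_5 by (simp add: has_lie_derivative_def \<alpha>_def)
  have smooth_derivative: "smooth_on U (lie_derivative X (?f m))" if "smooth_on U X" for X m
    using that smooth_component by (rule smooth_on_lie_derivative)
  have derivative: "has_lie_derivative (?E 5) U (lie_derivative X (?f m))
      (lie_derivative (?E 5) (lie_derivative X (?f m)))" if "smooth_on U X" for X m
    using smooth_derivative[OF that] by (simp add: has_lie_derivative_def)
  have f5: "has_lie_derivative (?E 5) U (?f 5) (lie_derivative (?E 5) (?f 5))"
    using smooth_component by (simp add: has_lie_derivative_def)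
  have first: "lie_derivative (?E 4) (?f 4) y = lie_derivative (?E 5) (?f 5) y * \<alpha> y" if y: "y \<in> U" for y
  proof -
    have W4: "lie_derivative jet_field (?f 4) z = f z $ 5 * \<alpha> z" if "z \<in> U" for z
      using maps_flag[of 4 z "jet_field z"] that by (simp add: \<alpha>_def lie_derivative_component flag_iff)
    have "lie_derivative (?E 5) (lie_derivative jet_field (?f 4)) y = lie_derivative (?E 4) (?f 4) y"
      unfolding lie_derivative_axis_jet_field[OF smooth_component y] lie_bracket_axis_jet_field using y
      by (simp add: lie_derivative_eq_0[OF open_domain] component_4 axis_in_characteristic)
    with has_lie_derivative_unique[OF derivative[OF smooth_on_jet_field[OF open_domain]]
        has_lie_derivative_mult[OF f5 E5\<alpha>] W4 y]
    show ?thesis by simp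
  qed
  have "lie_derivative (?E 5) (lie_derivative (?E 4) (?f 4)) x = 0"
    unfolding lie_derivative_const_commute[OF smooth_component x] using x
    by (simp add: lie_derivative_eq_0[OF open_domain] component_4 axis_in_characteristic)
  with has_lie_derivative_unique[OF derivative[OF sE] has_lie_derivative_mult[OF derivative[OF sE] E5\<alpha>] first x]
  have "lie_derivative (?E 5) (lie_derivative (?E 5) (?f 5)) x * \<alpha> x = 0" by simp
  then show ?thesis using lie_derivative_jet_field_ne_0[OF x] by (simp add: \<alpha>_def)
qed

end

text \<open>The constant \<open>c\<close> of \<open>\<theta>\<^sub>0\<close> is read off by differentiating along \<open>K = kappa2 0\<close>. With
  \<open>\<alpha> = W f\<^sub>1\<close> and \<open>\<beta> = K f\<^sub>5\<close>, the form \<open>\<theta>\<^sub>3\<close> gives \<open>f\<^sub>6 * \<beta> = x\<^sub>6 * \<alpha>\<close>. Each application of \<open>K\<close>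
  replaces \<open>x\<^sub>6, x\<^sub>7, x\<^sub>8 + 1\<close> by the next one and \<open>f\<^sub>6, f\<^sub>7, f\<^sub>8 + 1\<close> by the next one times \<open>\<beta>\<close>; so
  after two of them \<open>\<beta>\<^sup>3 = \<alpha>\<close> at zero, and after three
  \<open>c' * \<beta>\<^sup>4 + 6 * \<beta>\<^sup>2 * K \<beta> = 3 * K \<alpha>\<close>. At zero \<open>K = \<partial>\<^sub>5 + \<partial>\<^sub>7\<close>, which kills \<open>\<alpha>\<close>, and it kills
  \<open>\<beta>\<close> because \<open>f\<^sub>5\<close> is affine in \<open>x\<^sub>5\<close>. What remains is \<open>c' * \<beta>\<^sup>4 = 0\<close> with \<open>\<beta> \<noteq> 0\<close>.\<close>

lemma normal_form_constant_zero:
  fixes f :: "real^9 \<Rightarrow> real^9"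
  assumes "flag_map 0 c' U f" and zU: "0 \<in> U" and f0: "f 0 = 0"
  shows "c' = 0"
proof -
  interpret flag_map 0 c' U f by fact
  note U = open_domain
  let ?f = "\<lambda>m x. f x $ m" and ?E = "\<lambda>k (_::real^9). axis k 1 :: real^9"
  let ?W = jet_field and ?K = "kappa2 0"
  have sE: "smooth_on U (?E k)" for k using U by (rule smooth_on_const)
  have sW: "smooth_on U ?W" and sK: "smooth_on U ?K"
    using U by (rule smooth_on_jet_field, rule smooth_on_kappa2)
  have sx: "smooth_on U (\<lambda>x. x $ m)" for m :: 9
    using U by (intro smooth_on_vec_nth smooth_on_id)
  note sf = smooth_component and sL = smooth_on_lie_derivative
  define \<alpha> where "\<alpha> = lie_derivative ?W (?f 1)"
  define \<beta> where "\<beta> = lie_derivative ?K (?f 5)"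
  define \<alpha>1 where "\<alpha>1 = lie_derivative ?K \<alpha>"
  define \<beta>1 where "\<beta>1 = lie_derivative ?K \<beta>"
  define \<alpha>2 where "\<alpha>2 = lie_derivative ?K \<alpha>1"
  define \<beta>2 where "\<beta>2 = lie_derivative ?K \<beta>1"
  have s: "smooth_on U \<alpha>" "smooth_on U \<beta>" "smooth_on U \<alpha>1" "smooth_on U \<beta>1" "smooth_on U \<alpha>2" "smooth_on U \<beta>2"
    unfolding \<alpha>_def \<beta>_def \<alpha>1_def \<beta>1_def \<alpha>2_def \<beta>2_def by (intro sL sK sW sf)+

  \<comment> \<open>\<open>f\<^sub>1\<close> does not see \<open>K - x\<^sub>6 W\<close>, and \<open>f\<^sub>5\<close> sees only the part \<open>\<partial>\<^sub>5\<close> of it\<close>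
  have K_split: "lie_derivative ?K (?f m) x = x$6 * lie_derivative ?W (?f m) x
      + lie_derivative (\<lambda>x. ?K x - x$6 *\<^sub>R ?W x) (?f m) x" if "x \<in> U" for x m
    using linear_derivative[OF that] that
    by (simp add: lie_derivative_component linear_diff linear_cmul)
  have rest: "?K x - x$6 *\<^sub>R ?W x \<in> characteristic 4 x" "?K x - x$6 *\<^sub>R ?W x - axis 5 1 \<in> characteristic 3 x" for x
    by (simp_all add: characteristic_iff) (simp_all add: axis_def)
  have Kf1: "lie_derivative ?K (?f 1) x = x$6 * \<alpha> x" if x: "x \<in> U" for x
    unfolding K_split[OF x] \<alpha>_def using rest(1)[of x] x
    by (subst component_1) (auto simp: characteristic_iff)
  have \<beta>_eq: "\<beta> x = x$6 * lie_derivative ?W (?f 5) x + lie_derivative (?E 5) (?f 5) x" if x: "x \<in> U" for x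
  proof -
    have "lie_derivative (\<lambda>x. ?K x - x$6 *\<^sub>R ?W x - axis 5 1) (?f 5) x = 0"
      using rest(2) x by (rule component_5)
    then show ?thesis
      using x linear_derivative[OF x] unfolding \<beta>_def K_split[OF x]
      by (simp add: lie_derivative_component linear_diff)
  qed

  have K0: "?K 0 = axis 5 1 + axis 7 1"
    unfolding vec_eq_iff forall_9 by simp (simp add: axis_def)
  have K_at_0: "lie_derivative ?K h 0 = lie_derivative (?E 5) h 0 + lie_derivative (?E 7) h 0"
    if "smooth_on U h" for h :: "real^9 \<Rightarrow> real"
    using linear_frechet_derivative[OF smooth_on_differentiable[OF that zU]]
    by (simp add: lie_derivative_def K0 linear_add)
  have \<alpha>1_0: "\<alpha>1 0 = 0"
    using K_at_0[OF s(1)] lie_derivative_jet_1_axis_5[OF zU] lie_derivative_jet_1_axis_7[OF zU]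
    by (simp add: \<alpha>1_def \<alpha>_def)
  have D\<alpha>: "has_lie_derivative ?K U \<alpha> \<alpha>1" "has_lie_derivative ?K U \<alpha>1 \<alpha>2"
    "has_lie_derivative ?K U \<alpha>2 (lie_derivative ?K \<alpha>2)"
    and D\<beta>: "has_lie_derivative ?K U \<beta> \<beta>1" "has_lie_derivative ?K U \<beta>1 \<beta>2"
    "has_lie_derivative ?K U \<beta>2 (lie_derivative ?K \<beta>2)"
    using s by (simp_all add: has_lie_derivative_def \<alpha>1_def \<alpha>2_def \<beta>1_def \<beta>2_def)
  have Dx: "has_lie_derivative ?K U (\<lambda>x. x$6) (\<lambda>x. x$7)" "has_lie_derivative ?K U (\<lambda>x. x$7) (\<lambda>x. x$8 + 1)"
    "has_lie_derivative ?K U (\<lambda>x. x$8) (\<lambda>x. x$9)"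
    using sx by (simp_all add: has_lie_derivative_def)
  have \<beta>1_0: "\<beta>1 0 = 0"
  proof -
    have E5f5: "smooth_on U (lie_derivative (?E 5) (?f 5))"
      by (intro sL sE sf)
    have D: "has_lie_derivative ?K U (lie_derivative X (?f 5)) (lie_derivative ?K (lie_derivative X (?f 5)))"
      if "smooth_on U X" for X
      using sL[OF that sf] by (simp add: has_lie_derivative_def)
    have "\<beta>1 0 = lie_derivative ?K (lie_derivative (?E 5) (?f 5)) 0"
      using has_lie_derivative_unique[OF D\<beta>(1)
          has_lie_derivative_add[OF has_lie_derivative_mult[OF Dx(1) D[OF sW]] D[OF sE]] \<beta>_eq zU]
      by simp
    also have "\<dots> = lie_derivative (?E 7) (lie_derivative (?E 5) (?f 5)) 0"
      unfolding K_at_0[OF E5f5] component_5_affine[OF zU] by simp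
    also have "\<dots> = 0"
      unfolding lie_derivative_const_commute[OF sf zU] using zU
      by (simp add: lie_derivative_eq_0[OF U] component_5 axis_in_characteristic)
    finally show ?thesis .
  qed

  have K_in: "frechet_derivative f (at x) (?K x) \<in> flag c' 0 (f x)" if "x \<in> U" for x
    using that by (intro maps_flag) (simp_all add: flag_iff)
  have Df: "has_lie_derivative ?K U (?f 6) (\<lambda>x. f x$7 * \<beta> x)"
    "has_lie_derivative ?K U (?f 7) (\<lambda>x. (f x$8 + 1) * \<beta> x)"
    "has_lie_derivative ?K U (?f 8) (\<lambda>x. (f x$9 + c') * \<beta> x)"
    using sf K_in by (simp_all add: has_lie_derivative_def \<beta>_def lie_derivative_component flag_iff)
  note m = has_lie_derivative_mult and p = has_lie_derivative_add and const = has_lie_derivative_const[OF U]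
  have eq0: "f x$6 * \<beta> x = x$6 * \<alpha> x" if "x \<in> U" for x
    using Kf1[OF that] K_in[OF that] that by (simp add: lie_derivative_component \<beta>_def flag_iff)
  have eq1: "f x$7 * \<beta> x * \<beta> x + f x$6 * \<beta>1 x = x$7 * \<alpha> x + x$6 * \<alpha>1 x" if "x \<in> U" for x
    using has_lie_derivative_unique[OF m[OF Df(1) D\<beta>(1)] m[OF Dx(1) D\<alpha>(1)] eq0 that] .
  have eq2: "(f x$8 + 1) * (\<beta> x * (\<beta> x * \<beta> x)) + 3 * (f x$7 * (\<beta> x * \<beta>1 x)) + f x$6 * \<beta>2 x
      = (x$8 + 1) * \<alpha> x + 2 * (x$7 * \<alpha>1 x) + x$6 * \<alpha>2 x" if x: "x \<in> U" for x
    using has_lie_derivative_unique[OF p[OF m[OF m[OF Df(2) D\<beta>(1)] D\<beta>(1)] m[OF Df(1) D\<beta>(2)]]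
        p[OF m[OF Dx(2) D\<alpha>(1)] m[OF Dx(1) D\<alpha>(2)]] eq1 x]
    by (simp add: algebra_simps)
  \<comment> \<open>only the derivative at zero is needed, where all terms with a factor \<open>x\<^sub>m\<close> or \<open>f\<^sub>m\<close> drop out\<close>
  have eq3: "c' * \<beta> 0 ^ 4 + 6 * \<beta> 0 ^ 2 * \<beta>1 0 = 3 * \<alpha>1 0"
    using has_lie_derivative_unique[OF
        p[OF p[OF m[OF p[OF Df(3) const] m[OF D\<beta>(1) m[OF D\<beta>(1) D\<beta>(1)]]]
            m[OF const m[OF Df(2) m[OF D\<beta>(1) D\<beta>(2)]]]] m[OF Df(1) D\<beta>(3)]]
        p[OF p[OF m[OF p[OF Dx(3) const] D\<alpha>(1)] m[OF const m[OF Dx(2) D\<alpha>(2)]]] m[OF Dx(1) D\<alpha>(3)]]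
        eq2 zU]
    by (simp add: f0 power2_eq_square power4_eq_xxxx mult_ac)
  have "\<beta> 0 \<noteq> 0"
  proof
    assume "\<beta> 0 = 0"
    then have "\<alpha> 0 = 0" using eq2[OF zU] f0 by simp
    then show False using lie_derivative_jet_field_ne_0[OF zU] by (simp add: \<alpha>_def)
  qed
  then show "c' = 0" using eq3 by (simp add: \<alpha>1_0 \<beta>1_0)
qed

text \<open>A diffeomorphism has injective derivatives, by the chain rule for its inverse.\<close>

lemma injective_diffeomorphism_derivative:
  assumes "diffeomorphism U V f g" "x \<in> U"
  shows "inj (frechet_derivative f (at x))"
proof -
  have f: "smooth_on U f" and g: "smooth_on V g" and hom: "homeomorphism U V f g"
    using assms(1) by (auto simp: diffeomorphism_def)
  have "f x \<in> V" "\<And>y. y \<in> U \<Longrightarrow> g (f y) = y"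
    using hom assms(2) by (auto simp: homeomorphism_def)
  then have "((\<lambda>y. g (f y)) has_derivative
      (\<lambda>v. frechet_derivative g (at (f x)) (frechet_derivative f (at x) v))) (at x)"
    by (intro has_derivative_compose[OF smooth_on_has_derivative[OF f assms(2)] smooth_on_has_derivative[OF g]])
  moreover have "((\<lambda>y. g (f y)) has_derivative (\<lambda>v. v)) (at x)"
    by (rule has_derivative_transform_within_open[OF has_derivative_ident smooth_on_open[OF f] assms(2)])
      (use \<open>\<And>y. y \<in> U \<Longrightarrow> g (f y) = y\<close> in simp)
  ultimately have "(\<lambda>v. frechet_derivative g (at (f x)) (frechet_derivative f (at x) v)) = (\<lambda>v. v)"
    by (rule has_derivative_unique)
  then show ?thesis by (metis injI)
qed

lemma not_locally_equivalent:
  assumes "c' \<noteq> 0"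
  shows "\<not> locally_equivalent_at_zero (kumpera_ruiz 0) (kumpera_ruiz c')"
proof
  assume "locally_equivalent_at_zero (kumpera_ruiz 0) (kumpera_ruiz c')"
  then obtain U V f g where zU: "0 \<in> U" and diff: "diffeomorphism U V f g" and f0: "f 0 = 0"
    and maps: "\<forall>x\<in>U. frechet_derivative f (at x) ` kumpera_ruiz 0 x = kumpera_ruiz c' (f x)"
    unfolding locally_equivalent_at_zero_def by blast
  have "flag_map 0 c' U f"
  proof
    show "smooth_on U f" using diff by (simp add: diffeomorphism_def)
    show "inj (frechet_derivative f (at x))" if "x \<in> U" for x
      using diff that by (rule injective_diffeomorphism_derivative)
    show "frechet_derivative f (at x) v \<in> flag c' 0 (f x)" if "x \<in> U" "v \<in> flag 0 0 x" for x v
      using maps that unfolding flag_0 by blast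
  qed
  from normal_form_constant_zero[OF this zU f0] show False using assms by simp
qed

theorem proposition7p6:
  shows "goursat (kumpera_ruiz 0) \<and> goursat (kumpera_ruiz 1) \<and>
    \<not> locally_equivalent_at_zero (kumpera_ruiz 0) (kumpera_ruiz 1) \<and>
    singularity_type (kumpera_ruiz 0) 0 = [\<aa> 0, \<aa> 0, \<aa> 1, \<aa> 2, \<aa> 0, \<aa> 0] \<and>
    singularity_type (kumpera_ruiz 1) 0 = [\<aa> 0, \<aa> 0, \<aa> 1, \<aa> 2, \<aa> 0, \<aa> 0]"
  using goursat_kumpera_ruiz not_locally_equivalent[of 1] singularity_type_zero by simp

end
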